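(* Assume the Continuum Hypothesis. Let $\mathcal I$ be a tall P-ideal on $\omega$ that contains all singletons, and let $\gamma \leq \omega_1$ be an ordinal with $\gamma \geq 1$. Then there exists an $\mathcal I$-ultrafilter $u$ on $\omega$ which belongs to the class $\mathcal P_\gamma$ of the P-hierarchy.
   Context: An ideal $\mathcal I$ on $\omega$ is tall if every infinite subset of $\omega$ contains an infinite subset belonging to $\mathcal I$; it is a P-ideal if for every countable family $\{I_n\}\subset\mathcal I$ there is $I\in\mathcal I$ with $I_n\setminus I$ finite for all $n$. An ultrafilter $u$ on $\omega$ is an $\mathcal I$-ultrafilter if for every function $f:\omega\to\omega$ there is $U\in u$ with $f[U]\in\mathcal I$. Cascades: a cascade is a tree $V$ without infinite branches and with a least element $\emptyset_V$. It is sequential if for each non-maximal $v\in V$ the set $v^+$ of immediate successors of $v$ is countably infinite. The rank $r(v)$ is defined by $r(v)=0$ for maximal $v$, and otherwise $r(v)$ is the least ordinal greater than the ranks of all immediate successors of $v$; $r(V)=r(\emptyset_V)$. $V$ is monotone if every $v^+$ ($v$ non-maximal) can be enumerated as $(v_n)_{n<\omega}$ with $(r(v_n))_n$ non-decreasing. For $v\in V$, $v^{\uparrow}$ denotes the subcascade consisting of $v$ and all its successors. The contour $\int V$ of a sequential cascade $V$ is the filter on $\max V$ (the set of maximal elements) that is the trace on $\max V$ of the neighborhood filter of $\emptyset_V$ in the finest topology on $V$ in which, for every non-maximal $v$, the cofinite filter on $v^+$ converges to $v$; equivalently, $\int v^\uparrow$ is the principal filter of $\{v\}$ for maximal $v$,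 and $\int v^\uparrow=\bigcup_{G\in\mathcal{F}r(v^+)}\bigcap_{w\in G}\int w^\uparrow$ otherwise, with $\mathcal{F}r(v^+)$ the cofinite filter on $v^+$. A monotone sequential contour on a countable set $X$ (identified with $\omega$) is $\int V$ for a monotone sequential cascade $V$ with $\max V = X$; its rank is $r(V)$ (this is independent of the choice of $V$). A filter on a subset of $\omega$ is identified with the filter on $\omega$ it generates. P-hierarchy: for $1\leq\alpha<\omega_1$, an ultrafilter $u$ on $\omega$ belongs to $\mathcal P_\alpha$ if $u$ contains no monotone sequential contour of rank $\alpha$, while for every $\beta$ with $1\leq\beta<\alpha$ some monotone sequential contour of rank $\beta$ is contained in $u$. $u\in\mathcal P_{\omega_1}$ if for every $\alpha<\omega_1$ some monotone sequential contour of rank $\alpha$ is contained in $u$. (Thus $\mathcal P_1$ is the class of principal ultrafilters and $\mathcal P_2$ is the class of P-points.) *)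

theory Defs
  imports Complex_Main "HOL-Library.Countable_Set"
begin

unbundle cardinal_syntax

section \<open>Ordinals\<close>

text \<open>
  Ordinals are order types of well-orders on sets of type \<open>nat set set\<close>. Since
  \<open>cardSuc natLeq\<close> is such a well-order, \<open>\<omega>\<^sub>1\<close> and all countable ordinals are
  values of this type.
\<close>

lemma part_equivp_ordIso: "part_equivp (\<lambda>r s :: nat set rel. r =o s)"
proof (rule part_equivpI)
  show "\<exists>r :: nat set rel. r =o r"
    using card_of_Well_order ordIso_reflexive by blast
  show "symp (\<lambda>r s :: nat set rel. r =o s)"
    by (rule sympI) (rule ordIso_symmetric)
  show "transp (\<lambda>r s :: nat set rel. r =o s)"
    by (intro transpI) (rule ordIso_transitive)
qed

quotient_type ordinal = "nat set rel" / partial: "\<lambda>r s. r =o s"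
  by (rule part_equivp_ordIso)

instantiation ordinal :: "{wellorder, zero, one}"
begin

lift_definition less_eq_ordinal :: "ordinal \<Rightarrow> ordinal \<Rightarrow> bool" is "\<lambda>r s. r \<le>o s"
proof -
  fix r r' s s' :: "nat set rel"
  assume "r =o r'" "s =o s'"
  then show "(r \<le>o s) = (r' \<le>o s')"
    using ordIso_ordLeq_trans ordLeq_ordIso_trans ordIso_symmetric[of r r'] ordIso_symmetric[of s s']
    by blast
qed

lift_definition less_ordinal :: "ordinal \<Rightarrow> ordinal \<Rightarrow> bool" is "\<lambda>r s. r <o s"
proof -
  fix r r' s s' :: "nat set rel"
  assume "r =o r'" "s =o s'"
  then show "(r <o s) = (r' <o s')"
    using ordIso_ordLess_trans ordLess_ordIso_trans ordIso_symmetric[of r r'] ordIso_symmetric[of s s']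
    by blast
qed

lift_definition zero_ordinal :: ordinal is "{}"
  by (rule ordIso_reflexive) simp

lift_definition one_ordinal :: ordinal is "{({}, {})}"
  by (rule ordIso_reflexive)
    (auto simp: well_order_on_def linear_order_on_def partial_order_on_def preorder_on_def
      refl_on_def trans_def antisym_def Field_def total_on_def)

instance
proof
  fix a b c :: ordinal
  show "(a < b) = (a \<le> b \<and> \<not> b \<le> a)"
  proof transfer
    fix r s :: "nat set rel"
    assume "r =o r" "s =o s"
    then have "Well_order r" "Well_order s"
      unfolding ordIso_def by simp_all
    then show "(r <o s) = (r \<le>o s \<and> \<not> s \<le>o r)"
      using not_ordLeq_iff_ordLess ordLess_imp_ordLeq by blast
  qed
  show "a \<le> a"
    by transfer (simp add: ordIso_iff_ordLeq)
  show "a \<le> c" if "a \<le> b" "b \<le> c"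
    using that by transfer (rule ordLeq_transitive)
  show "a = b" if "a \<le> b" "b \<le> a"
    using that by transfer (simp add: ordIso_iff_ordLeq)
  show "a \<le> b \<or> b \<le> a"
  proof transfer
    fix r s :: "nat set rel"
    assume "r =o r" "s =o s"
    then have "Well_order r" "Well_order s"
      unfolding ordIso_def by simp_all
    then show "r \<le>o s \<or> s \<le>o r"
      by (rule ordLeq_total)
  qed
next
  fix P :: "ordinal \<Rightarrow> bool" and a :: ordinal
  assume step: "\<And>x. (\<And>y. y < x \<Longrightarrow> P y) \<Longrightarrow> P x"
  have "wf (inv_image ordLess rep_ordinal)"
    by (rule wf_inv_image[OF wf_ordLess])
  moreover have "{(x, y). x < y} \<subseteq> inv_image ordLess rep_ordinal"
    by (auto simp: less_ordinal_def)
  ultimately have "wf {(x, y :: ordinal). x < y}"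
    by (rule wf_subset)
  then show "P a"
    by (rule wf_induct_rule) (rule step, simp)
qed

end

lift_definition omega_one :: ordinal  (\<open>\<omega>\<^sub>1\<close>) is "cardSuc natLeq"
  by (rule ordIso_reflexive[OF card_order_on_well_order_on[OF cardSuc_Card_order[OF natLeq_Card_order]]])

definition continuum_hypothesis :: bool where
  "continuum_hypothesis \<longleftrightarrow> |UNIV :: nat set set| =o cardSuc natLeq"


unbundle no cardinal_syntax


section \<open>Ideals and ultrafilters\<close>

definition is_ideal :: "nat set set \<Rightarrow> bool" where
  "is_ideal \<I> \<longleftrightarrow> {} \<in> \<I> \<and> (\<forall>A\<in>\<I>. \<forall>B. B \<subseteq> A \<longrightarrow> B \<in> \<I>) \<and> (\<forall>A\<in>\<I>. \<forall>B\<in>\<I>. A \<union> B \<in> \<I>)"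

definition is_tall :: "nat set set \<Rightarrow> bool" where
  "is_tall \<I> \<longleftrightarrow> (\<forall>A. infinite A \<longrightarrow> (\<exists>B\<in>\<I>. B \<subseteq> A \<and> infinite B))"

definition is_P_ideal :: "nat set set \<Rightarrow> bool" where
  "is_P_ideal \<I> \<longleftrightarrow> is_ideal \<I> \<and>
     (\<forall>S :: nat \<Rightarrow> nat set. range S \<subseteq> \<I> \<longrightarrow> (\<exists>A\<in>\<I>. \<forall>n. finite (S n - A)))"

text \<open>
  For \<open>u :: 'a filter\<close>, a set \<open>A\<close> belongs to the filter iff \<open>eventually (\<lambda>x. x \<in> A) u\<close>;
  \<open>u \<le> F\<close> says that every element of \<open>F\<close> is an element of \<open>u\<close>.
\<close>

definition ultrafilter :: "'a filter \<Rightarrow> bool" where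
  "ultrafilter u \<longleftrightarrow> u \<noteq> bot \<and>
     (\<forall>A. eventually (\<lambda>x. x \<in> A) u \<or> eventually (\<lambda>x. x \<in> - A) u)"

definition ideal_ultrafilter :: "nat set set \<Rightarrow> nat filter \<Rightarrow> bool" where
  "ideal_ultrafilter \<I> u \<longleftrightarrow> ultrafilter u \<and>
     (\<forall>f :: nat \<Rightarrow> nat. \<exists>U. eventually (\<lambda>n. n \<in> U) u \<and> f ` U \<in> \<I>)"


section \<open>Cascades\<close>

text \<open>
  A cascade is given by its (reflexive) order relation \<open>V\<close>; its vertex set is \<open>Field V\<close>.
\<close>

definition branch :: "'v rel \<Rightarrow> 'v set \<Rightarrow> bool" where
  "branch V C \<longleftrightarrow> C \<in> Chains V \<and> (\<forall>D\<in>Chains V. C \<subseteq> D \<longrightarrow> D = C)"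

definition tree :: "'v rel \<Rightarrow> bool" where
  "tree V \<longleftrightarrow> Partial_order V \<and> (\<forall>v\<in>Field V. well_order_on (under V v) (Restr V (under V v)))"

definition is_least :: "'v rel \<Rightarrow> 'v \<Rightarrow> bool" where
  "is_least V b \<longleftrightarrow> b \<in> Field V \<and> (\<forall>v\<in>Field V. (b, v) \<in> V)"

definition cascade :: "'v rel \<Rightarrow> bool" where
  "cascade V \<longleftrightarrow> tree V \<and> (\<forall>C. branch V C \<longrightarrow> finite C) \<and> (\<exists>b. is_least V b)"

definition cascade_root :: "'v rel \<Rightarrow> 'v" where
  "cascade_root V = (THE b. is_least V b)"

definition max_elems :: "'v rel \<Rightarrow> 'v set" where
  "max_elems V = {v \<in> Field V. aboveS V v = {}}"

definition succs :: "'v rel \<Rightarrow> 'v \<Rightarrow> 'v set" where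
  "succs V v = {w \<in> aboveS V v. \<forall>x\<in>aboveS V v. (x, w) \<in> V \<longrightarrow> x = w}"

definition sequential :: "'v rel \<Rightarrow> bool" where
  "sequential V \<longleftrightarrow>
     (\<forall>v\<in>Field V - max_elems V. countable (succs V v) \<and> infinite (succs V v))"

text \<open>
  In a cascade, \<open>succ_rel\<close> is well-founded, so that the two recursions below satisfy the
  expected equations, see \<open>rank_at_rec\<close> and \<open>contour_at_rec\<close>.
\<close>

definition succ_rel :: "'v rel \<Rightarrow> 'v rel" where
  "succ_rel V = {(w, v). w \<in> succs V v}"

definition rank_at :: "'v rel \<Rightarrow> 'v \<Rightarrow> ordinal" where
  "rank_at V = wfrec (succ_rel V) (\<lambda>rk v.
     if v \<in> max_elems V then 0 else LEAST \<alpha>. \<forall>w\<in>succs V v. rk w < \<alpha>)"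

definition cascade_rank :: "'v rel \<Rightarrow> ordinal" where
  "cascade_rank V = rank_at V (cascade_root V)"

definition monotone_cascade :: "'v rel \<Rightarrow> bool" where
  "monotone_cascade V \<longleftrightarrow> (\<forall>v\<in>Field V - max_elems V.
     \<exists>e :: nat \<Rightarrow> 'v. bij_betw e UNIV (succs V v) \<and> mono (\<lambda>n. rank_at V (e n)))"


section \<open>Contours\<close>

text \<open>
  \<open>contour_at V v\<close> is the contour of the subcascade of \<open>V\<close> consisting of \<open>v\<close> and all its
  successors. All these contours are taken as filters on the type of vertices, i.e. a filter on
  a set is identified with the filter on the whole type generated by it. In the order of
  \<open>'v filter\<close>, \<open>SUP\<close> is the intersection of filters; the \<open>INF\<close> is over a family directed by
  inclusion, and hence is its union (see \<open>eventually_contour_at\<close>).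
\<close>

definition contour_at :: "'v rel \<Rightarrow> 'v \<Rightarrow> 'v filter" where
  "contour_at V = wfrec (succ_rel V) (\<lambda>c v.
     if v \<in> max_elems V then principal {v}
     else (INF G\<in>{G. G \<subseteq> succs V v \<and> finite (succs V v - G)}. SUP w\<in>G. c w))"

definition contour :: "'v rel \<Rightarrow> 'v filter" where
  "contour V = contour_at V (cascade_root V)"

text \<open>
  The monotone sequential contours of rank \<open>\<alpha>\<close> on subsets \<open>X\<close> of \<open>\<omega>\<close>, as filters on \<open>\<omega>\<close>.
  The map \<open>l\<close> identifies \<open>max V\<close> with \<open>X\<close>; as sequential cascades are countable, it is no
  restriction that the vertices are natural numbers.
\<close>

definition ms_contours :: "ordinal \<Rightarrow> nat filter set" where
  "ms_contours \<alpha> = {filtermap l (contour V) | (V :: nat rel) (l :: nat \<Rightarrow> nat).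
     cascade V \<and> sequential V \<and> monotone_cascade V \<and> cascade_rank V = \<alpha> \<and> inj_on l (max_elems V)}"

definition contains_ms_contour :: "nat filter \<Rightarrow> ordinal \<Rightarrow> bool" where
  "contains_ms_contour u \<alpha> \<longleftrightarrow> (\<exists>F\<in>ms_contours \<alpha>. u \<le> F)"

text \<open>The classes \<open>P_class \<gamma>\<close> are meant for \<open>1 \<le> \<gamma> \<le> \<omega>\<^sub>1\<close> only.\<close>

definition P_class :: "ordinal \<Rightarrow> nat filter set" where
  "P_class \<gamma> =
     (if \<gamma> = \<omega>\<^sub>1
      then {u. ultrafilter u \<and> (\<forall>\<alpha>. 1 \<le> \<alpha> \<and> \<alpha> < \<omega>\<^sub>1 \<longrightarrow> contains_ms_contour u \<alpha>)}
      else {u. ultrafilter u \<and> \<not> contains_ms_contour u \<gamma> \<and>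
               (\<forall>\<beta>. 1 \<le> \<beta> \<and> \<beta> < \<gamma> \<longrightarrow> contains_ms_contour u \<beta>)})"


section \<open>The recursion equations\<close>

lemma wf_succ_rel:
  assumes "cascade V"
  shows "wf (succ_rel V)"
proof -
  have tr: "trans V" and an: "antisym V" and po: "Partial_order V"
    using assms by (auto simp: cascade_def tree_def order_on_defs)
  show ?thesis
  proof (rule ccontr)
    assume "\<not> wf (succ_rel V)"
    then obtain f where f: "\<And>i. f (Suc i) \<in> succs V (f i)"
      by (auto simp: wf_iff_no_infinite_down_chain succ_rel_def)
    have step: "(f i, f (Suc i)) \<in> V" "f i \<noteq> f (Suc i)" for i
      using f[of i] by (auto simp: succs_def aboveS_def)
    have lt: "(f i, f j) \<in> V \<and> f i \<noteq> f j" if "i < j" for i j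
      using that
    proof (induction rule: less_Suc_induct)
      case (1 i)
      then show ?case using step by blast
    next
      case (2 i j k)
      then show ?case using tr an by (metis antisymD transD)
    qed
    have refl: "(f i, f i) \<in> V" for i
      using po step(1)[of i] by (auto simp: order_on_defs refl_on_def Field_def)
    have "inj f"
      by (metis injI lt linorder_neqE_nat)
    then have inf: "infinite (range f)"
      by (rule range_inj_infinite)
    have chain: "range f \<in> Chains V"
      using lt refl unfolding Chains_def by (auto) (metis linorder_neqE_nat)
    define \<C> where "\<C> = {C \<in> Chains V. range f \<subseteq> C}"
    have "\<exists>M\<in>\<C>. \<forall>X\<in>\<C>. M \<subseteq> X \<longrightarrow> X = M"
    proof (rule subset_Zorn_nonempty)
      show "\<C> \<noteq> {}" using chain by (auto simp: \<C>_def)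
    next
      fix K assume K: "K \<noteq> {}" "subset.chain \<C> K"
      have "(a, b) \<in> V \<or> (b, a) \<in> V" if "a \<in> A" "A \<in> K" "b \<in> B" "B \<in> K" for a b A B
      proof -
        have "A \<subseteq> B \<or> B \<subseteq> A" "A \<in> Chains V" "B \<in> Chains V"
          using K that by (auto simp: subset_chain_def \<C>_def)
        then show ?thesis using that by (auto simp: Chains_def)
      qed
      moreover obtain A where "A \<in> K"
        using K(1) by blast
      then have "range f \<subseteq> \<Union>K"
        using K(2) unfolding subset_chain_def \<C>_def by blast
      ultimately show "\<Union>K \<in> \<C>"
        unfolding \<C>_def Chains_def by blast
    qed
    then obtain M where M: "M \<in> \<C>" "\<And>X. X \<in> \<C> \<Longrightarrow> M \<subseteq> X \<Longrightarrow> X = M" by blast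
    have "branch V M"
      unfolding branch_def using M by (auto simp: \<C>_def)
    moreover have "infinite M"
      using M(1) inf by (auto simp: \<C>_def dest: finite_subset)
    ultimately show False using assms by (auto simp: cascade_def)
  qed
qed

lemma rank_at_rec:
  assumes "cascade V"
  shows "rank_at V v =
    (if v \<in> max_elems V then 0 else LEAST \<alpha>. \<forall>w\<in>succs V v. rank_at V w < \<alpha>)"
  unfolding rank_at_def
  by (subst wfrec[OF wf_succ_rel[OF assms]]) (simp add: cut_def succ_rel_def)

lemma contour_at_rec:
  assumes "cascade V"
  shows "contour_at V v =
    (if v \<in> max_elems V then principal {v}
     else (INF G\<in>{G. G \<subseteq> succs V v \<and> finite (succs V v - G)}. SUP w\<in>G. contour_at V w))"
proof -
  have "(SUP w\<in>G. cut c (succ_rel V) v w) = (SUP w\<in>G. c w)"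
    if "G \<subseteq> succs V v" for G and c :: "'a \<Rightarrow> 'a filter"
    by (rule SUP_cong) (use that in \<open>auto simp: cut_def succ_rel_def\<close>)
  then show ?thesis
    unfolding contour_at_def
    by (subst wfrec[OF wf_succ_rel[OF assms]]) (auto intro!: INF_cong)
qed

lemma eventually_contour_at:
  assumes "cascade V" "v \<notin> max_elems V"
  shows "eventually P (contour_at V v) \<longleftrightarrow>
    (\<exists>G \<subseteq> succs V v. finite (succs V v - G) \<and> (\<forall>w\<in>G. eventually P (contour_at V w)))"
proof -
  let ?\<G> = "{G. G \<subseteq> succs V v \<and> finite (succs V v - G)}"
  have "eventually P (INF G\<in>?\<G>. SUP w\<in>G. contour_at V w) \<longleftrightarrow>
    (\<exists>G\<in>?\<G>. eventually P (SUP w\<in>G. contour_at V w))"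
  proof (rule eventually_INF_base)
    have "succs V v \<in> ?\<G>" by simp
    then show "?\<G> \<noteq> {}" by blast
  next
    fix G H assume "G \<in> ?\<G>" "H \<in> ?\<G>"
    then have "G \<inter> H \<in> ?\<G>" by (simp add: Diff_Int le_infI1)
    then show "\<exists>K\<in>?\<G>. (SUP w\<in>K. contour_at V w) \<le>
        inf (SUP w\<in>G. contour_at V w) (SUP w\<in>H. contour_at V w)"
      by (intro bexI[of _ "G \<inter> H"]) (auto intro!: SUP_subset_mono)
  qed
  then show ?thesis
    using assms by (auto simp: contour_at_rec[OF assms(1), of v] eventually_Sup)
qed

end

theory Submission
  imports Defs "HOL-Library.Disjoint_Sets" "HOL-Library.Countable_Set_Type"
begin

text \<open>
  A contour of positive rank is \<open>limf G\<close>, the filter of sets that belong to almost all \<open>G n\<close>, for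
  contours \<open>G n\<close> of smaller rank on disjoint sets; this makes induction on contours available.
  The ultrafilter is generated by a decreasing \<open>\<omega>\<^sub>1\<close>-chain in a \<open>\<sigma>\<close>-closed order that meets
  \<open>\<omega>\<^sub>1 = 2\<^sup>\<omega>\<close> dense sets.

  For \<open>1 < \<gamma> < \<omega>\<^sub>1\<close> fix an increasing sequence of contours with ranks cofinal below \<open>\<gamma>\<close> which are
  limits over one common partition of \<open>\<omega>\<close>. The conditions are the sets that are positive for the
  union \<open>F\<close> of these contours, ordered by inclusion modulo \<open>F\<close>. This order is \<open>\<sigma>\<close>-closed by a
  diagonal intersection along the partition. A contour \<open>H\<close> of rank \<open>\<gamma>\<close> can always be excluded,
  because a positive trace of a contour of smaller rank never contains \<open>H\<close>. For
  \<open>\<gamma> = \<omega>\<^sub>1\<close> the conditions are sequences of contours of arbitrary countable ranks on the pieces of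
  a partition, and it is dense to raise all ranks beyond a given bound. In both cases the
  P-ideal property and tallness yield, inside every positive set, a positive set
  with image in \<open>\<I>\<close>: choose such sets in infinitely many pieces, absorb their images into one
  element of \<open>\<I>\<close> up to finite sets, and thin out.
\<close>

section \<open>Countable ordinals\<close>

unbundle cardinal_syntax

text \<open>Sets, functions and contours are all coded by sets of natural numbers, so under the
  continuum hypothesis one list of length \<open>\<omega>\<^sub>1\<close> contains every task, and
  each stage of the chain has only countably many predecessors. For countable \<gamma> the obstacle
  is to destroy every contour of rank \<gamma> without losing the smaller ones. Hence the smaller
  ones are fixed beforehand, and a condition only has to remain positive for all of them. Below
  \<open>\<omega>\<^sub>1\<close> no countable set of ranks is cofinal, but there is also nothing to
  exclude, so there the ranks grow along the chain instead. Enlarging contours piece by piece has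
  one exception: a principal filter cannot be enlarged. Therefore pieces of rank 0 are used only for
  \<gamma> = 2, and all ranks of pieces are kept positive for larger \<gamma> and in the case of
  \<open>\<omega>\<^sub>1\<close>. Level 1 lies outside both constructions and consists of principal
  ultrafilters. Working with an inductive predicate instead of trees requires both directions of the
  translation: cascades must yield contours in order to be excluded, and contours must yield
  cascades in order to witness membership in the classes.\<close>

lemma Well_order_rep_ordinal: "Well_order (rep_ordinal a)"
  using Quotient_rep_reflp[OF Quotient_ordinal] unfolding ordIso_def by blast

lemma rep_abs_ordinal:
  assumes "Well_order r"
  shows "rep_ordinal (abs_ordinal r) =o r"
  using Quotient_rep_abs[OF Quotient_ordinal] assms ordIso_reflexive by blast

lemma abs_ordinal_less_iff:
  assumes "Well_order r"
  shows "abs_ordinal r < a \<longleftrightarrow> r <o rep_ordinal a"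
  using rep_abs_ordinal[OF assms] unfolding less_ordinal_def
  by (auto intro: ordIso_ordLess_trans ordIso_symmetric)

text \<open>The proper initial segments of a well-order of type \<open>a\<close> are pairwise
  non-isomorphic and represent every smaller order type, so the type of the segment below
  \<open>x\<close> gives the bijection.\<close>

lemma ex_bij_betw_lessThan_ordinal:
  "\<exists>h. bij_betw h (Field (rep_ordinal a)) {..<a}"
proof -
  let ?s = "rep_ordinal a"
  let ?r = "\<lambda>x. Restr ?s (underS ?s x)"
  let ?h = "\<lambda>x. abs_ordinal (?r x)"
  note wo = Well_order_rep_ordinal[of a]
  have wor: "Well_order (?r x)" for x
    by (rule Well_order_Restr[OF wo])
  have ofil: "wo_rel.ofilter ?s (underS ?s x)" for x
    using wo by (simp add: wo_rel_def wo_rel.underS_ofilter)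
  have less: "?r x <o ?r y" if "(x, y) \<in> ?s" "x \<noteq> y" for x y
  proof -
    have tr: "trans ?s" and an: "antisym ?s"
      using wo by (auto simp: order_on_defs)
    have "underS ?s x \<subset> underS ?s y"
      using that tr an unfolding underS_def by (auto dest: antisymD transD)
    then show ?thesis
      using ofilter_subset_ordLess[OF wo ofil ofil] by blast
  qed
  have "inj_on ?h (Field ?s)"
  proof (rule inj_onI, rule ccontr)
    fix x y assume xy: "x \<in> Field ?s" "y \<in> Field ?s" "?h x = ?h y" "x \<noteq> y"
    then have iso: "?r x =o ?r y"
      by (metis rep_abs_ordinal[OF wor] ordIso_symmetric ordIso_transitive)
    have "total_on (Field ?s) ?s"
      using wo by (auto simp: order_on_defs)
    then have "(x, y) \<in> ?s \<or> (y, x) \<in> ?s"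
      using xy by (auto simp: total_on_def)
    then have "?r x <o ?r y \<or> ?r y <o ?r x"
      using less xy(4) by blast
    then show False
      using iso not_ordLess_ordIso ordIso_symmetric by blast
  qed
  moreover have "?h ` Field ?s = {..<a}"
  proof
    show "?h ` Field ?s \<subseteq> {..<a}"
      using underS_Restr_ordLess[OF wo] abs_ordinal_less_iff[OF wor] by blast
    show "{..<a} \<subseteq> ?h ` Field ?s"
    proof
      fix b assume "b \<in> {..<a}"
      then have "rep_ordinal b <o ?s"
        by (simp add: less_ordinal_def)
      then obtain x where "x \<in> Field ?s" "rep_ordinal b =o ?r x"
        using ordLess_iff_ordIso_Restr[OF wo Well_order_rep_ordinal] by blast
      then have "abs_ordinal (rep_ordinal b) = ?h x"
        by (intro Quotient_rel_abs[OF Quotient_ordinal])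
      then show "b \<in> ?h ` Field ?s"
        using \<open>x \<in> Field ?s\<close> Quotient_abs_rep[OF Quotient_ordinal] by simp
    qed
  qed
  ultimately show ?thesis unfolding bij_betw_def by blast
qed

lemma card_lessThan_ordinal: "|{..<a}| =o |Field (rep_ordinal a)|"
  using ex_bij_betw_lessThan_ordinal card_of_ordIso ordIso_symmetric by blast

lemma rep_omega_one: "rep_ordinal \<omega>\<^sub>1 =o cardSuc natLeq"
  unfolding omega_one_def
  by (intro rep_abs_ordinal card_order_on_well_order_on[OF cardSuc_Card_order[OF natLeq_Card_order]])

lemma card_lessThan_omega_one: "|{..<\<omega>\<^sub>1}| =o cardSuc natLeq"
proof -
  have "|Field (rep_ordinal \<omega>\<^sub>1)| =o |Field (cardSuc natLeq)|"
    by (rule card_of_cong[OF rep_omega_one])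
  also have "|Field (cardSuc natLeq)| =o cardSuc natLeq"
    by (rule card_of_Field_ordIso[OF cardSuc_Card_order[OF natLeq_Card_order]])
  finally show ?thesis
    using card_lessThan_ordinal ordIso_transitive by blast
qed

lemma uncountable_lessThan_omega_one: "uncountable {..<\<omega>\<^sub>1}"
proof
  assume "countable {..<\<omega>\<^sub>1}"
  then have "cardSuc natLeq \<le>o natLeq"
    using ordIso_ordLeq_trans[OF ordIso_symmetric[OF card_lessThan_omega_one]]
    by (simp add: countable_card_le_natLeq)
  then show False
    using cardSuc_greater[OF natLeq_Card_order] not_ordLess_ordLeq by blast
qed

lemma countable_lessThan_ordinal:
  assumes "a < \<omega>\<^sub>1"
  shows "countable {..<a}"
proof -
  have "rep_ordinal a <o cardSuc natLeq"
    using assms rep_omega_one ordLess_ordIso_trans by (auto simp: less_ordinal_def)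
  moreover have "|Field (rep_ordinal a)| \<le>o rep_ordinal a"
    by (rule card_of_least[OF Well_order_rep_ordinal])
  ultimately have "|{..<a}| <o cardSuc natLeq"
    using card_lessThan_ordinal ordIso_ordLeq_trans ordLeq_ordLess_trans by blast
  then show ?thesis
    unfolding countable_card_le_natLeq
    using cardSuc_ordLeq_ordLess[OF natLeq_Card_order card_of_Card_order] by blast
qed

lemma continuum_hypothesis_enum:
  assumes continuum_hypothesis
  obtains e :: "ordinal \<Rightarrow> nat set" where "e ` {..<\<omega>\<^sub>1} = UNIV"
proof -
  have "|{..<\<omega>\<^sub>1}| =o |UNIV :: nat set set|"
    using assms card_lessThan_omega_one ordIso_transitive ordIso_symmetric
    unfolding continuum_hypothesis_def by blast
  then show ?thesis
    using that card_of_ordIso bij_betw_imp_surj_on by metis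
qed



lemma bij_betw_lessThan_abs_ordinal:
  assumes "Well_order r"
  shows "\<exists>h. bij_betw h (Field r) {..<abs_ordinal r}"
  using card_lessThan_ordinal[of "abs_ordinal r"] card_of_cong[OF rep_abs_ordinal[OF assms]]
  unfolding card_of_ordIso by (meson ordIso_symmetric ordIso_transitive)

unbundle no cardinal_syntax

section \<open>Zero, one and strict suprema of sequences of countable ordinals\<close>

lemma zero_ordinal_le [simp]: "(0::ordinal) \<le> a"
proof -
  have "Well_order ({} :: nat set rel)"
    by (simp add: order_on_defs)
  then obtain h :: "nat set \<Rightarrow> ordinal" where "bij_betw h (Field {}) {..<0}"
    using bij_betw_lessThan_abs_ordinal unfolding zero_ordinal_def by blast
  then have "{..<0::ordinal} = {}"
    by (simp add: bij_betw_def)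
  then show ?thesis
    using leI by blast
qed

lemma not_less_zero_ordinal [simp]: "\<not> a < (0::ordinal)"
  by (simp add: not_less)

lemma less_one_ordinal [simp]: "(a::ordinal) < 1 \<longleftrightarrow> a = 0"
proof -
  have "Well_order {({}::nat set, {}::nat set)}"
    by (auto simp: order_on_defs refl_on_def trans_def antisym_def Field_def total_on_def)
  then obtain h where "bij_betw h (Field {({}::nat set, {}::nat set)}) {..<1::ordinal}"
    using bij_betw_lessThan_abs_ordinal unfolding one_ordinal_def by blast
  then have eq: "{..<1::ordinal} = {h {}}"
    by (simp add: bij_betw_def Field_def)
  then have "h {} < 1"
    by blast
  then have "0 < (1::ordinal)"
    using zero_ordinal_le le_less_trans by blast
  then have "{..<1::ordinal} = {0}"
    using eq by (metis lessThan_iff singletonD)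
  then show ?thesis
    by (metis lessThan_iff singleton_iff)
qed

lemma one_le_ordinal_iff: "(1::ordinal) \<le> a \<longleftrightarrow> a \<noteq> 0"
  by (simp flip: not_less)

text \<open>An unbounded countable \<open>A\<close> would make \<open>\<omega>\<^sub>1\<close> a
  countable union of countable segments.\<close>

lemma countable_ordinals_bounded:
  assumes "countable A" "\<And>a. a \<in> A \<Longrightarrow> a < \<omega>\<^sub>1"
  shows "\<exists>b < \<omega>\<^sub>1. \<forall>a\<in>A. a < b"
proof (rule ccontr)
  assume "\<not> ?thesis"
  then have "\<And>b. b < \<omega>\<^sub>1 \<Longrightarrow> \<exists>a\<in>A. b \<le> a"
    by (meson not_le)
  then have "{..<\<omega>\<^sub>1} \<subseteq> (\<Union>a\<in>A. insert a {..<a})"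
    by (force simp: le_less)
  moreover have "countable (\<Union>a\<in>A. insert a {..<a})"
    using assms countable_lessThan_ordinal by (intro countable_UN) auto
  ultimately show False
    using uncountable_lessThan_omega_one countable_subset by blast
qed

text \<open>This is the rank of a vertex whose immediate successors are enumerated with ranks
  \<open>a n\<close>.\<close>

definition strict_sup :: "(nat \<Rightarrow> ordinal) \<Rightarrow> ordinal" where
  "strict_sup a = (LEAST \<alpha>. \<forall>n. a n < \<alpha>)"

context
  fixes a :: "nat \<Rightarrow> ordinal"
  assumes a: "\<And>n. a n < \<omega>\<^sub>1"
begin

lemma less_strict_sup: "a n < strict_sup a"
proof -
  obtain b where "\<forall>n. a n < b"
    using countable_ordinals_bounded[of "range a"] a by auto
  then show ?thesis
    unfolding strict_sup_def using LeastI[of "\<lambda>\<alpha>. \<forall>n. a n < \<alpha>" b] by blast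
qed

lemma strict_sup_less_omega_one: "strict_sup a < \<omega>\<^sub>1"
proof -
  obtain b where "b < \<omega>\<^sub>1" "\<forall>n. a n < b"
    using countable_ordinals_bounded[of "range a"] a by auto
  then show ?thesis
    unfolding strict_sup_def using Least_le[of "\<lambda>\<alpha>. \<forall>n. a n < \<alpha>" b] by (meson le_less_trans)
qed

lemma less_strict_sup_iff: "b < strict_sup a \<longleftrightarrow> (\<exists>n. b \<le> a n)"
proof
  assume "b < strict_sup a"
  then show "\<exists>n. b \<le> a n"
    unfolding strict_sup_def using not_less_Least[of b "\<lambda>\<alpha>. \<forall>n. a n < \<alpha>"] by (auto simp: not_less)
qed (use less_strict_sup le_less_trans in blast)

end

lemma strict_sup_eqI:
  assumes "\<And>n. a n < \<omega>\<^sub>1" "\<And>b. b < \<alpha> \<longleftrightarrow> (\<exists>n. b \<le> a n)"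
  shows "strict_sup a = \<alpha>"
  using less_strict_sup_iff[of a] assms by (metis not_less_iff_gr_or_eq)

lemma strict_sup_ge_one:
  assumes "\<And>n. a n < \<omega>\<^sub>1"
  shows "1 \<le> strict_sup a"
  using less_strict_sup[of a 0] assms one_le_ordinal_iff by auto

lemma strict_sup_max:
  assumes "\<And>n. a n < \<omega>\<^sub>1" "\<And>n. b n < \<omega>\<^sub>1"
  shows "strict_sup (\<lambda>n. max (a n) (b n)) = max (strict_sup a) (strict_sup b)"
  by (rule strict_sup_eqI)
     (use assms in \<open>auto simp: less_max_iff_disj le_max_iff_disj less_strict_sup_iff\<close>)

lemma strict_sup_subseq:
  assumes "\<And>n. a n < \<omega>\<^sub>1" "mono a" "infinite (range k)" 
  shows "strict_sup (\<lambda>n. a (k n)) = strict_sup a"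
proof (rule strict_sup_eqI)
  fix b
  have "\<exists>m. n \<le> k m" for n
    using assms(3) by (metis infinite_nat_iff_unbounded_le rangeE)
  then show "b < strict_sup a \<longleftrightarrow> (\<exists>n. b \<le> a (k n))"
    unfolding less_strict_sup_iff[OF assms(1)] using assms(2) by (meson monoD order_trans)
qed (use assms in auto)

lemma strict_sup_const_zero: "strict_sup (\<lambda>_. 0) = 1"
  unfolding strict_sup_def by (rule Least_equality) (auto simp: one_le_ordinal_iff)

lemma strict_sup_eq_one_iff:
  assumes "\<And>n. a n < \<omega>\<^sub>1"
  shows "strict_sup a = 1 \<longleftrightarrow> (\<forall>n. a n = 0)"
  using less_strict_sup[of a] strict_sup_const_zero assms by (metis ext less_one_ordinal)

text \<open>Running maxima of an enumeration of the ordinals below \<alpha> are cofinal. Successors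
  and limits are treated alike: for a successor the sequence becomes constant and
  \<open>strict_sup\<close> adds one.\<close>

lemma ordinal_fundamental_sequence:
  assumes "1 \<le> \<alpha>" "\<alpha> < \<omega>\<^sub>1"
  obtains a where "mono a" "\<And>n. a n < \<omega>\<^sub>1" "strict_sup a = \<alpha>"
proof -
  have "0 < \<alpha>"
    using assms(1) by (metis less_one_ordinal less_le_trans)
  then have ne: "{..<\<alpha>} \<noteq> {}"
    by blast
  define e where "e = from_nat_into {..<\<alpha>}"
  have range: "range e = {..<\<alpha>}"
    unfolding e_def using ne countable_lessThan_ordinal[OF assms(2)] by (rule range_from_nat_into)
  define a where "a n = Max (e ` {..n})" for n
  have "a n \<in> range e" for n
    unfolding a_def using Max_in[of "e ` {..n}"] by fastforce
  then have lt: "a n < \<alpha>" for n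
    using range by blast
  moreover have ge: "e n \<le> a n" for n
    unfolding a_def by (rule Max_ge) auto
  moreover have "mono a"
    unfolding a_def by (intro monoI Max_mono) auto
  moreover have "strict_sup a = \<alpha>"
  proof (rule strict_sup_eqI)
    show "b < \<alpha> \<longleftrightarrow> (\<exists>n. b \<le> a n)" for b
      using range lt ge by (metis lessThan_iff rangeE le_less_trans)
  qed (use lt assms in \<open>auto intro: less_trans\<close>)
  ultimately show ?thesis
    using that assms(2) less_trans by blast
qed

lemma one_less_omega_one: "1 < \<omega>\<^sub>1"
proof -
  have "0 < \<omega>\<^sub>1"
    using uncountable_lessThan_omega_one by (metis countable_empty ex_in_conv le_less_trans lessThan_iff zero_ordinal_le)
  then show ?thesis
    using strict_sup_less_omega_one[of "\<lambda>_. 0"] strict_sup_const_zero by simp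
qed

lemma less_strict_sup_const: "\<alpha> < \<omega>\<^sub>1 \<Longrightarrow> \<alpha> < strict_sup (\<lambda>_. \<alpha>)"
  using less_strict_sup[of "\<lambda>_. \<alpha>"] by simp


section \<open>Limits of filters and inductively generated contours\<close>

text \<open>A Fubini-type limit along the cofinite filter. Applied to an enumeration of the
  immediate successors of a vertex, it is the recursion step of the contour.\<close>

definition limf :: "(nat \<Rightarrow> 'a filter) \<Rightarrow> 'a filter" where
  "limf G = Abs_filter (\<lambda>P. \<forall>\<^sub>F n in sequentially. eventually P (G n))"

lemma eventually_limf:
  "eventually P (limf G) \<longleftrightarrow> (\<forall>\<^sub>F n in sequentially. eventually P (G n))"
  unfolding limf_def
proof (rule eventually_Abs_filter, rule is_filter.intro)
  fix P Q :: "'a \<Rightarrow> bool"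
  assume "\<forall>\<^sub>F n in sequentially. eventually P (G n)"
  then show "\<forall>x. P x \<longrightarrow> Q x \<Longrightarrow> \<forall>\<^sub>F n in sequentially. eventually Q (G n)"
    by (auto elim!: eventually_mono)
  assume "\<forall>\<^sub>F n in sequentially. eventually P (G n)" "\<forall>\<^sub>F n in sequentially. eventually Q (G n)"
  then show "\<forall>\<^sub>F n in sequentially. \<forall>\<^sub>F x in G n. P x \<and> Q x"
    by eventually_elim (rule eventually_conj)
qed simp

lemma frequently_limf:
  "frequently P (limf G) \<longleftrightarrow> (\<exists>\<^sub>F n in sequentially. frequently P (G n))"
  by (simp add: frequently_def eventually_limf)

lemma limf_mono:
  assumes "\<forall>\<^sub>F n in sequentially. F n \<le> G n"
  shows "limf F \<le> limf G"
  unfolding le_filter_def eventually_limf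
proof (intro allI impI)
  fix P assume "\<forall>\<^sub>F n in sequentially. eventually P (G n)"
  with assms show "\<forall>\<^sub>F n in sequentially. eventually P (F n)"
    by eventually_elim (rule filter_leD)
qed

lemma limf_subseq_le:
  assumes "strict_mono k"
  shows "limf (\<lambda>n. G (k n)) \<le> limf G"
  unfolding le_filter_def eventually_limf
  using assms filterlim_subseq[OF assms] by (auto simp: filterlim_iff)

lemma limf_shift: "limf (\<lambda>n. G (n + k)) = limf G"
    unfolding filter_eq_iff eventually_limf
  by (intro allI) (rule eventually_sequentially_seg)

lemma filtermap_limf: "filtermap l (limf G) = limf (\<lambda>n. filtermap l (G n))"
  by (rule filter_eqI) (simp add: eventually_limf eventually_filtermap)

text \<open>Rank and carrier are indices of the predicate, so that restricting, raising and lowering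
  become inductions that mention no tree. Monotonicity of \<open>a\<close> mirrors the monotone
  cascades.\<close>

inductive contour_on :: "ordinal \<Rightarrow> nat set \<Rightarrow> nat filter \<Rightarrow> bool" where
  point: "contour_on 0 {x} (principal {x})"
| lim: "contour_on (strict_sup a) (\<Union>n. X n) (limf G)"
  if "\<And>n. contour_on (a n) (X n) (G n)" "mono a" "disjoint_family X"

lemma contour_on_less_omega_one: "contour_on a X G \<Longrightarrow> a < \<omega>\<^sub>1"
proof (induction rule: contour_on.induct)
  case (point x)
  show ?case using one_less_omega_one by (metis less_trans less_one_ordinal)
next
  case (lim a X G)
  then show ?case by (intro strict_sup_less_omega_one)
qed

lemma contour_on_nonempty: "contour_on a X G \<Longrightarrow> X \<noteq> {}"
  by (induction rule: contour_on.induct) auto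

lemma contour_on_eventually: "contour_on a X G \<Longrightarrow> eventually (\<lambda>x. x \<in> X) G"
proof (induction rule: contour_on.induct)
  case (lim a X G)
  have "eventually (\<lambda>x. x \<in> (\<Union>n. X n)) (G n)" for n
    using lim.IH[of n] by (rule eventually_mono) blast
  then show ?case
    by (simp add: eventually_limf)
qed (simp add: eventually_principal)

lemma contour_on_neq_bot: "contour_on a X G \<Longrightarrow> G \<noteq> bot"
proof (induction rule: contour_on.induct)
  case (lim a X G)
  then show ?case
    by (simp add: trivial_limit_def eventually_limf eventually_False_sequentially)
qed (simp add: principal_eq_bot_iff)

lemma contour_on_limE:
  assumes "contour_on a X G" "a \<noteq> 0"
  obtains r Y H where "a = strict_sup r" "X = (\<Union>n. Y n)" "G = limf H" "mono r"
    "disjoint_family Y" "\<And>n. contour_on (r n) (Y n) (H n)" "\<And>n. r n < \<omega>\<^sub>1"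
  using assms contour_on_less_omega_one by cases (auto, blast)

lemma contour_on_zeroE:
  assumes "contour_on 0 X G"
  obtains x where "X = {x}" "G = principal {x}"
  using assms
proof cases
  case (lim r Y H)
  then show ?thesis
    using strict_sup_ge_one[of r] contour_on_less_omega_one one_le_ordinal_iff by metis
qed (use that in blast)

lemma contour_on_infinite: 
  assumes "contour_on a X G" "a \<noteq> 0"
  shows "infinite X"
proof -
  obtain r Y H where *: "a = strict_sup r" "X = (\<Union>n. Y n)" "G = limf H" "mono r"
    "disjoint_family Y" "\<And>n. contour_on (r n) (Y n) (H n)" "\<And>n. r n < \<omega>\<^sub>1"
    by (rule contour_on_limE[OF assms]) (rule that)
  have "inj Y"
    using *(5) contour_on_nonempty[OF *(6)]
    by (metis disjoint_family_on_def inf.idem injI UNIV_I)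
  then show ?thesis 
    unfolding *(2) by (metis finite_UnionD finite_imageD infinite_UNIV_nat)
qed

lemma disjoint_family_unique:
  assumes "disjoint_family X" "x \<in> X m" "x \<in> X n"
  shows "m = n"
  using assms unfolding disjoint_family_on_def by blast

lemma disjoint_family_eventually_notin:
  fixes Y :: "nat \<Rightarrow> 'a set"
  assumes "disjoint_family Y" "finite B"
  shows "\<forall>\<^sub>F n in sequentially. B \<inter> Y n = {}"
proof -
  have "\<forall>\<^sub>F n in sequentially. b \<notin> Y n" for b
  proof (cases "\<exists>m. b \<in> Y m")
    case True
    then obtain m where "b \<in> Y m" by blast
    then have "\<forall>n>m. b \<notin> Y n"
      using assms(1) unfolding disjoint_family_on_def by (metis IntI UNIV_I empty_iff less_irrefl)
    then show ?thesis
      unfolding eventually_sequentially using Suc_le_lessD by blast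
  qed auto
  then have "\<forall>\<^sub>F n in sequentially. \<forall>b\<in>B. b \<notin> Y n"
    using assms(2) by (simp add: eventually_ball_finite)
  then show ?thesis
    by (auto elim: eventually_mono)
qed

text \<open>A finite set meets only finitely many of the disjoint pieces of a limit.\<close>

lemma contour_on_free:
  assumes "contour_on a X G" "a \<noteq> 0" "finite B"
  shows "eventually (\<lambda>x. x \<notin> B) G"
proof -
  obtain r Y H where *: "a = strict_sup r" "X = (\<Union>n. Y n)" "G = limf H" "mono r"
    "disjoint_family Y" "\<And>n. contour_on (r n) (Y n) (H n)" "\<And>n. r n < \<omega>\<^sub>1"
    by (rule contour_on_limE[OF assms(1,2)]) (rule that)
  show ?thesis
    unfolding *(3) eventually_limf
    using disjoint_family_eventually_notin[OF *(5) assms(3)]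
  proof eventually_elim
    case (elim n)
    show ?case using contour_on_eventually[OF *(6)[of n]] by (rule eventually_mono) (use elim in blast)
  qed
qed

lemma ex_frechet_contour:
  assumes "infinite X"
  shows "\<exists>G. contour_on 1 X G \<and> (\<forall>P. eventually P G \<longleftrightarrow> finite {x \<in> X. \<not> P x})"
proof -
  define e where "e = enumerate X"
  have e: "bij_betw e UNIV X"
    unfolding e_def by (rule bij_enumerate[OF assms])
  define G where "G = limf (\<lambda>n. principal {e n})"
  have inj: "inj e" and X: "X = range e"
    using bij_betw_imp_inj_on[OF e] bij_betw_imp_surj_on[OF e] by simp_all
  have "contour_on (strict_sup (\<lambda>_. 0)) (\<Union>n. {e n}) G"
    unfolding G_def
    by (rule contour_on.lim) (use inj in \<open>auto simp: mono_def disjoint_family_on_def inj_def intro: contour_on.point\<close>)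
  moreover have "(\<Union>n. {e n}) = X"
    using X by auto
  moreover have "eventually P G \<longleftrightarrow> finite {x \<in> X. \<not> P x}" for P
  proof -
    have "{x \<in> X. \<not> P x} = e ` {n. \<not> P (e n)}"
      using X by auto
    then show ?thesis
      unfolding G_def eventually_limf eventually_principal
      using inj by (simp add: finite_image_iff inj_on_subset eventually_cofinite flip: cofinite_eq_sequentially)
  qed
  ultimately show ?thesis
    unfolding strict_sup_const_zero by auto
qed

text \<open>Every contour of positive rank is free, hence refines the cofinite filter of any set
  around its carrier. This settles lowering to rank 1.\<close>

lemma frechet_le:
  assumes "contour_on a Y G" "a \<noteq> 0" "Y \<subseteq> X" "\<forall>P. eventually P F \<longleftrightarrow> finite {x \<in> X. \<not> P x}"
  shows "G \<le> F"
proof (rule filter_leI)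
  fix P assume "eventually P F"
  then have "eventually (\<lambda>x. x \<notin> {x \<in> X. \<not> P x}) G"
    using contour_on_free[OF assms(1,2)] assms(4) by blast
  then show "eventually P G"
    using contour_on_eventually[OF assms(1)] by eventually_elim (use assms(3) in auto)
qed

definition piece :: "(nat \<Rightarrow> nat) \<Rightarrow> nat \<Rightarrow> nat set" where
  "piece e i = (\<lambda>k. e (prod_encode (i, k))) ` UNIV"

lemma piece_props:
  assumes "inj e"
  shows "disjoint_family (piece e)" "infinite (piece e i)" "piece e i \<subseteq> range e"
proof -
  show "disjoint_family (piece e)"
    using assms by (auto simp: disjoint_family_on_def piece_def inj_eq)
  show "infinite (piece e i)"
    unfolding piece_def by (intro range_inj_infinite injI) (metis assms injD prod_encode_eq prod.inject)
  show "piece e i \<subseteq> range e"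
    by (auto simp: piece_def)
qed

lemma infinite_partition:
  fixes X :: "nat set"
  assumes "infinite X"
  obtains Y :: "nat \<Rightarrow> nat set" where "disjoint_family Y" "\<And>i. infinite (Y i)" "\<And>i. Y i \<subseteq> X"
proof -
  have "bij_betw (enumerate X) UNIV X"
    by (rule bij_enumerate[OF assms])
  then show ?thesis
    using piece_props[of "enumerate X"] that[of "piece (enumerate X)"] by (auto simp: bij_betw_def)
qed

section \<open>Existence of contours, change of rank, restriction to positive sets\<close>

lemma ex_contour_on:
  assumes "infinite X" "a < \<omega>\<^sub>1"
  shows "\<exists>Y G. Y \<subseteq> X \<and> contour_on a Y G"
  using assms
proof (induction a arbitrary: X rule: less_induct)
  case (less a)
  show ?case
  proof (cases "a = 0")
    case True
    obtain x where "x \<in> X"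
      using infinite_imp_nonempty[OF less.prems(1)] by blast
    then have "{x} \<subseteq> X \<and> contour_on a {x} (principal {x})"
      using contour_on.point True by blast
    then show ?thesis by blast
  next
    case False
    then obtain r where r: "mono r" "\<And>n. r n < \<omega>\<^sub>1" "strict_sup r = a"
      using ordinal_fundamental_sequence[of a] less.prems one_le_ordinal_iff by blast
    obtain Z where Z: "disjoint_family (Z :: nat \<Rightarrow> nat set)" "\<And>i. infinite (Z i)" "\<And>i. Z i \<subseteq> X"
      by (rule infinite_partition[OF less.prems(1)]) (rule that)
    have "\<forall>i. \<exists>Y G. Y \<subseteq> Z i \<and> contour_on (r i) Y G"
      using less.IH less_strict_sup[of r] r Z(2) by blast
    then obtain Y G where YG: "\<And>i. Y i \<subseteq> Z i" "\<And>i. contour_on (r i) (Y i) (G i)"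
      by metis
    have "disjoint_family Y"
      using Z(1) YG(1) by (rule disjoint_family_subset)
    then have "contour_on a (\<Union>n. Y n) (limf G)"
      using contour_on.lim[of r Y G] r YG by simp
    moreover have "(\<Union>n. Y n) \<subseteq> X"
      using Z(3) YG(1) by (meson UN_least order_trans)
    ultimately show ?thesis by blast
  qed
qed

text \<open>Raising the rank of a principal filter is impossible, whence the last assumption.\<close>

lemma contour_on_raise:
  assumes "contour_on a X G" "a \<le> b" "b < \<omega>\<^sub>1" "a = 0 \<longrightarrow> b = 0"
  shows "\<exists>Y H. Y \<subseteq> X \<and> H \<le> G \<and> contour_on b Y H"
  using assms
proof (induction arbitrary: b rule: contour_on.induct)
  case (point x)
  then show ?case using contour_on.point by blast
next
  case (lim a X G)
  have a: "a n < \<omega>\<^sub>1" for n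
    using lim.hyps contour_on_less_omega_one by blast
  have con: "contour_on (strict_sup a) (\<Union>n. X n) (limf G)"
    by (rule contour_on.lim) fact+
  have b0: "b \<noteq> 0"
    using order_trans[OF strict_sup_ge_one[of a, OF a] lim.prems(1)] one_le_ordinal_iff by blast
  show ?case
  proof (cases "strict_sup a = 1")
    \<comment> \<open>All pieces are principal and cannot be raised. Their limit is a cofinite
      filter, though, and any contour of rank \<open>b\<close> inside the carrier refines
      it.\<close>
    case True
    then have a0: "a n = 0" for n
      using strict_sup_eq_one_iff[of a, OF a] by blast
    have inf: "infinite (\<Union>n. X n)"
      using contour_on_infinite[OF con] strict_sup_ge_one[of a, OF a] one_le_ordinal_iff by blast
    obtain Y H where YH: "Y \<subseteq> (\<Union>n. X n)" "contour_on b Y H"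
      using ex_contour_on[OF inf lim.prems(2)] by blast
    have X: "\<exists>x. X n = {x} \<and> G n = principal {x}" for n
      using lim.hyps(1)[of n] unfolding a0[of n] by (elim contour_on_zeroE) blast
    then obtain x where x: "\<And>n. X n = {x n}" "\<And>n. G n = principal {x n}" by metis
    have "H \<le> limf G"
    proof (rule filter_leI)
      fix P assume "eventually P (limf G)"
      then have "finite {n. \<not> P (x n)}"
        unfolding eventually_limf x eventually_principal 
        by (simp add: eventually_cofinite flip: cofinite_eq_sequentially)
      then have "finite (x ` {n. \<not> P (x n)})"
        by blast
      then have "eventually (\<lambda>y. y \<notin> x ` {n. \<not> P (x n)}) H"
        by (rule contour_on_free[OF YH(2) b0])
      then show "eventually P H"
        using contour_on_eventually[OF YH(2)] by eventually_elim (use YH(1) x in auto)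
    qed
    then show ?thesis using YH by blast
  next
    case False
    then obtain k where "a k \<noteq> 0"
      using strict_sup_eq_one_iff[of a, OF a] by blast
    then have pos: "a (n + k) \<noteq> 0" for n
      using monoD[OF lim.hyps(2), of k "n + k"] by (metis le_add2 one_le_ordinal_iff order_trans)
    obtain r where r: "mono r" "\<And>n. r n < \<omega>\<^sub>1" "strict_sup r = b"
      using ordinal_fundamental_sequence[of b] lim.prems(2) b0 one_le_ordinal_iff by blast
    \<comment> \<open>Targets must dominate the present ranks and be cofinal in \<open>b\<close>.
      The maximum does both, and its strict supremum is still \<open>b\<close> because that of
      \<open>a\<close> is at most \<open>b\<close>.\<close>
    define s where "s n = max (r n) (a (n + k))" for n
    have "\<exists>Y H. Y \<subseteq> X (n + k) \<and> H \<le> G (n + k) \<and> contour_on (s n) Y H" for n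
      by (rule lim.IH) (use pos a r in \<open>auto simp: s_def\<close>)
    then obtain Y H where YH: "\<And>n. Y n \<subseteq> X (n + k)" "\<And>n. H n \<le> G (n + k)" 
      "\<And>n. contour_on (s n) (Y n) (H n)"
      by metis
    have ms: "mono s"
      unfolding s_def by (intro monoI max.mono monoD[OF r(1)] monoD[OF lim.hyps(2)]) simp_all
    have "disjoint_family (\<lambda>n. X (n + k))"
      using lim.hyps(3) by (auto simp: disjoint_family_on_def)
    then have dY: "disjoint_family Y"
      using YH(1) by (rule disjoint_family_subset)
    have "strict_sup (\<lambda>n. a (n + k)) = strict_sup a"
      by (rule strict_sup_subseq[of a, OF a lim.hyps(2)]) (simp add: range_inj_infinite)
    then have "strict_sup s = b"
      unfolding s_def using strict_sup_max[of r, OF r(2), of "\<lambda>n. a (n + k)"] a r(3) lim.prems(1) by simp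
    then have "contour_on b (\<Union>n. Y n) (limf H)"
      using contour_on.lim[OF YH(3) ms dY] by simp
    moreover have "limf H \<le> limf G"
      using limf_mono[of H "\<lambda>n. G (n + k)"] YH(2) limf_shift[of G k] by simp
    moreover have "(\<Union>n. Y n) \<subseteq> (\<Union>n. X n)"
      using YH(1) by blast
    ultimately show ?thesis by blast
  qed
qed

text \<open>The pieces stay, and their ranks are capped by a fundamental sequence of
  \<open>b\<close>. Some rank of a piece is at least \<open>b\<close> when \<open>b < a\<close>, so
  the cap is eventually attained and gives the right strict supremum. For \<open>b = 1\<close> the
  cofinite filter of \<open>X\<close> serves.\<close>

lemma contour_on_lower:
  assumes "contour_on a X G" "b \<le> a" "1 \<le> b"
  shows "\<exists>H. G \<le> H \<and> contour_on b X H"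
  using assms
proof (induction arbitrary: b rule: contour_on.induct)
  case (point x)
  then have "(1::ordinal) \<le> 0"
    using order_trans by blast
  then show ?case
    unfolding one_le_ordinal_iff by blast
next
  case (lim a X G)
  have a: "a n < \<omega>\<^sub>1" for n
    using lim.hyps contour_on_less_omega_one by blast
  have con: "contour_on (strict_sup a) (\<Union>n. X n) (limf G)"
    by (rule contour_on.lim) fact+
  have a0: "strict_sup a \<noteq> 0"
    using strict_sup_ge_one[of a, OF a] one_le_ordinal_iff by blast
  consider "b = strict_sup a" | "b = 1" | "1 < b" "b < strict_sup a"
    using lim.prems by fastforce
  then show ?case
  proof cases
    case 1
    then show ?thesis using con by blast
  next
    case 2
    then show ?thesis
      using ex_frechet_contour[OF contour_on_infinite[OF con a0]] frechet_le[OF con a0 subset_refl] by blast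
  next
    case 3
    have "b < \<omega>\<^sub>1"
      using 3 strict_sup_less_omega_one[of a] a by (metis less_trans)
    then obtain q where q: "mono q" "\<And>n. q n < \<omega>\<^sub>1" "strict_sup q = b"
      using ordinal_fundamental_sequence[of b] lim.prems(2) by blast
    \<comment> \<open>The maximum with 1 keeps the target positive on pieces of positive rank, as
      the induction hypothesis demands; pieces of rank 0 keep rank 0 under the minimum in
      \<open>s\<close>. As \<open>1 < b\<close>, the strict supremum remains
      \<open>b\<close>.\<close>
    define r where "r n = max 1 (q n)" for n
    have r: "mono r" "\<And>n. r n < \<omega>\<^sub>1"
      unfolding r_def using q(2) one_less_omega_one
      by (auto intro!: monoI max.mono monoD[OF q(1)])
    have "strict_sup r = max (strict_sup (\<lambda>_. 1)) (strict_sup q)"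
      unfolding r_def using strict_sup_max[of "\<lambda>_. 1" q] one_less_omega_one q(2) by simp
    moreover have "strict_sup (\<lambda>_. 1) \<le> b"
      using less_strict_sup_iff[of "\<lambda>_. 1" b] one_less_omega_one 3(1) by (metis not_le)
    ultimately have rb: "strict_sup r = b"
      using q(3) by simp
    define s where "s n = min (a n) (r n)" for n
    obtain m where m: "b \<le> a m"
      using 3(2) less_strict_sup_iff[of a b] a by blast
    have sr: "s (n + m) = r (n + m)" for n
    proof -
      have "r (n + m) < b"
        using less_strict_sup[of r] r(2) rb by simp
      also have "b \<le> a (n + m)"
        using m monoD[OF lim.hyps(2), of m "n + m"] by (meson le_add2 order_trans)
      finally show ?thesis by (simp add: s_def)
    qed
    have ms: "mono s"
      using r(1) lim.hyps(2) unfolding s_def by (intro monoI min.mono) (auto dest: monoD)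
    have s: "s n < \<omega>\<^sub>1" for n
      using a r unfolding s_def by (auto simp: min_less_iff_disj)
    have inf: "infinite (range (\<lambda>n::nat. n + m))"
      by (simp add: range_inj_infinite)
    have sb: "strict_sup s = b"
      using strict_sup_subseq[of s, OF s ms inf] strict_sup_subseq[of r, OF r(2,1) inf] sr rb by simp
    have "\<exists>H. G n \<le> H \<and> contour_on (s n) (X n) H" for n
    proof (cases "a n = 0")
      case True
      then show ?thesis using lim.hyps(1)[of n] unfolding s_def by (auto simp: min_def)
    next
      case False
      then show ?thesis
        by (intro lim.IH) (auto simp: s_def r_def one_le_ordinal_iff min_le_iff_disj le_max_iff_disj simp flip: one_le_ordinal_iff)
    qed
    then obtain H where H: "\<And>n. G n \<le> H n" "\<And>n. contour_on (s n) (X n) (H n)"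
      by metis
    have "contour_on b (\<Union>n. X n) (limf H)"
      using contour_on.lim[OF H(2) ms lim.hyps(3)] sb by simp
    moreover have "limf G \<le> limf H"
      using limf_mono[of G H] H(1) by simp
    ultimately show ?thesis by blast
  qed
qed

lemma frequently_sequentially_subseq:
  assumes "\<exists>\<^sub>F n in sequentially. P n"
  obtains k :: "nat \<Rightarrow> nat" where "strict_mono k" "\<And>n. P (k n)"
proof -
  have "infinite {n. P n}"
    using assms by (simp add: frequently_cofinite flip: cofinite_eq_sequentially)
  then show ?thesis
    using that infinite_enumerate by blast
qed

text \<open>A set positive for a limit is positive on infinitely many pieces, and the induction
  hypothesis restricts each of those. Discarding the others preserves the rank because the ranks are
  monotone.\<close>

lemma contour_on_restrict:
  assumes "contour_on a X G" "frequently (\<lambda>x. x \<in> A) G"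
  shows "\<exists>Y H. Y \<subseteq> X \<and> H \<le> G \<and> eventually (\<lambda>x. x \<in> A) H \<and> contour_on a Y H"
  using assms
proof (induction rule: contour_on.induct)
  case (point x)
  then have "eventually (\<lambda>y. y \<in> A) (principal {x})"
    by (auto simp: frequently_def eventually_principal)
  then show ?case
    using contour_on.point[of x] by blast
next
  case (lim a X G)
  have a: "a n < \<omega>\<^sub>1" for n
    using lim.hyps contour_on_less_omega_one by blast
  obtain k :: "nat \<Rightarrow> nat" where k: "strict_mono k" "\<And>n. frequently (\<lambda>x. x \<in> A) (G (k n))"
    by (rule frequently_sequentially_subseq[OF lim.prems[unfolded frequently_limf]]) (rule that)
  have "\<exists>Y H. Y \<subseteq> X (k n) \<and> H \<le> G (k n) \<and> eventually (\<lambda>x. x \<in> A) H \<and> contour_on (a (k n)) Y H" for n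
    using lim.IH k(2) by blast
  then obtain Y H where YH: "\<And>n. Y n \<subseteq> X (k n)" "\<And>n. H n \<le> G (k n)"
      "\<And>n. eventually (\<lambda>x. x \<in> A) (H n)" "\<And>n. contour_on (a (k n)) (Y n) (H n)"
    by metis
  have inj: "inj k"
    using k(1) strict_mono_imp_inj_on by blast
  have "disjoint_family (\<lambda>n. X (k n))"
    using lim.hyps(3) inj unfolding disjoint_family_on_def by (metis UNIV_I injD)
  then have dY: "disjoint_family Y"
    using YH(1) by (rule disjoint_family_subset)
  have "mono (\<lambda>n. a (k n))"
    by (intro monoI monoD[OF lim.hyps(2)]) (simp add: strict_mono_less_eq[OF k(1)])
  then have "contour_on (strict_sup (\<lambda>n. a (k n))) (\<Union>n. Y n) (limf H)"
    by (rule contour_on.lim[OF YH(4) _ dY])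
  then have "contour_on (strict_sup a) (\<Union>n. Y n) (limf H)"
    using strict_sup_subseq[of a k, OF a lim.hyps(2) range_inj_infinite[OF inj]] by simp
  moreover have "limf H \<le> limf (\<lambda>n. G (k n))"
    using YH(2) by (intro limf_mono) simp
  then have "limf H \<le> limf G"
    using limf_subseq_le[OF k(1), of G] by (rule order_trans)
  moreover have "(\<Union>n. Y n) \<subseteq> (\<Union>n. X n)"
    using YH(1) by blast
  moreover have "eventually (\<lambda>x. x \<in> A) (limf H)"
    using YH(3) by (simp add: eventually_limf)
  ultimately show ?case by blast
qed


section \<open>Contours contained in traces of contours\<close>

lemma frequently_Un:
  "frequently (\<lambda>x. x \<in> A \<union> B) F \<longleftrightarrow> frequently (\<lambda>x. x \<in> A) F \<or> frequently (\<lambda>x. x \<in> B) F"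
  by (simp add: frequently_disj_iff)

lemma frequently_UN_finite:
  assumes "finite J" "frequently (\<lambda>x. x \<in> (\<Union>j\<in>J. B j)) F"
  shows "\<exists>j\<in>J. frequently (\<lambda>x. x \<in> B j) F"
  using assms by (induction rule: finite_induct) (auto simp: frequently_disj_iff)

lemma frequently_subset:
  assumes "frequently (\<lambda>x. x \<in> A) F" "A \<subseteq> B"
  shows "frequently (\<lambda>x. x \<in> B) F"
  using assms by (auto elim: frequently_elim1)

lemma frequently_filter_mono:
  assumes "F \<le> G" "frequently P F"
  shows "frequently P G"
  using assms filter_leD unfolding frequently_def by blast

lemma frequently_Int:
  assumes "frequently (\<lambda>x. x \<in> A) F" "eventually (\<lambda>x. x \<in> B) F"
  shows "frequently (\<lambda>x. x \<in> A \<inter> B) F"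
  using frequently_eventually_conj[OF assms] by (auto elim: frequently_elim1)

lemma frequently_Diff:
  assumes "frequently (\<lambda>x. x \<in> A) F" "\<not> frequently (\<lambda>x. x \<in> B) F"
  shows "frequently (\<lambda>x. x \<in> A - B) F"
proof (rule ccontr)
  assume "\<not> ?thesis"
  then have "\<not> frequently (\<lambda>x. x \<in> (A - B) \<union> B) F"
    using assms(2) unfolding frequently_Un by simp
  then show False
    using frequently_subset[OF assms(1), of "(A - B) \<union> B"] by blast
qed

text \<open>On the piece \<open>Y j\<close> only the finitely many sets with \<open>k < j\<close>
  are intersected, so each piece keeps a member of its own filter although countably many families
  are met.\<close>

lemma eventually_limf_diagonal:
  assumes Y: "disjoint_family Y"
    and H: "\<And>n. eventually (\<lambda>x. x \<in> Y n) (H n)"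
    and B: "\<And>n k. eventually (\<lambda>x. x \<in> B n k) (H k)"
  shows "eventually (\<lambda>x. x \<in> (\<Union>j. Y j \<inter> (\<Inter>k\<in>{..<j}. B k j))) (limf H)"
proof -
  have "eventually (\<lambda>x. x \<in> Y j \<inter> (\<Inter>k\<in>{..<j}. B k j)) (H j)" for j
    using H[of j] B by (simp add: eventually_conj_iff eventually_ball_finite)
  then have "eventually (\<lambda>x. x \<in> (\<Union>j. Y j \<inter> (\<Inter>k\<in>{..<j}. B k j))) (H j)" for j
    by (rule eventually_mono) blast
  then show ?thesis
    by (simp add: eventually_limf)
qed

text \<open>
  No positive trace of a contour contains a contour of larger rank. The set \<open>B\<close> is built by
  diagonalization over the pieces \<open>X (i k)\<close> of the smaller contour on which \<open>A\<close> is positive; the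
  tails \<open>A'\<close> avoid the pieces of the larger contour whose rank may be too small.
\<close>

lemma contour_on_rank_less:
  assumes "contour_on b X G" "contour_on c Y H" "b < c" "frequently (\<lambda>x. x \<in> A) G"
  shows "\<exists>B. eventually (\<lambda>x. x \<in> B) H \<and> frequently (\<lambda>x. x \<in> A - B) G"
  using assms
proof (induction arbitrary: c Y H A rule: contour_on.induct)
  case (point x)
  then have "c \<noteq> 0" by auto
  have "x \<in> A"
    using point.prems(3) by (auto simp: frequently_def eventually_principal)
  then have "frequently (\<lambda>y. y \<in> A - (- {x})) (principal {x})"
    by (auto simp: frequently_def eventually_principal)
  then show ?case
    using contour_on_free[OF point.prems(1) \<open>c \<noteq> 0\<close>, of "{x}"] by (intro exI[of _ "- {x}"]) simp
next
  case (lim b X G)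
  have b: "b n < \<omega>\<^sub>1" for n
    using lim.hyps contour_on_less_omega_one by blast
  have c0: "c \<noteq> 0"
    using lim.prems(2) by auto
  obtain r Z K where c: "c = strict_sup r" "Y = (\<Union>n. Z n)" "H = limf K" "mono r"
    "disjoint_family Z" "\<And>n. contour_on (r n) (Z n) (K n)" "\<And>n. r n < \<omega>\<^sub>1"
    by (rule contour_on_limE[OF lim.prems(1) c0]) (rule that)
  \<comment> \<open>From \<open>j0\<close> on, every piece of the larger contour has greater rank
    than every piece of the smaller one.\<close>
  obtain j0 where j0: "strict_sup b \<le> r j0"
    using lim.prems(2) less_strict_sup_iff[of r, OF c(7)] unfolding c(1) by blast
  have rj: "b i < r j" if "j0 \<le> j" for i j
    using less_strict_sup[of b i, OF b] j0 monoD[OF c(4) that] by simp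
  have KZ: "eventually (\<lambda>x. x \<in> Z j) (K j)" for j
    by (rule contour_on_eventually[OF c(6)])
  have Zinf: "eventually (\<lambda>x. x \<notin> (\<Union>j\<in>{..m}. Z j)) H" for m
    unfolding c(3) eventually_limf eventually_sequentially
  proof (intro exI allI impI)
    fix n assume n: "Suc m \<le> n"
    show "eventually (\<lambda>x. x \<notin> (\<Union>j\<in>{..m}. Z j)) (K n)"
      using KZ[of n] by (rule eventually_mono)
        (use n in \<open>auto dest: disjoint_family_unique[OF c(5)]\<close>)
  qed
  show ?case
  proof (cases "\<exists>m. frequently (\<lambda>x. x \<in> A \<inter> (\<Union>j\<in>{..m}. Z j)) (limf G)")
    \<comment> \<open>The complement of finitely many \<open>Z j\<close> belongs to \<open>H\<close>
      and misses a positive part of \<open>A\<close>.\<close>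
    case True
    then obtain m where "frequently (\<lambda>x. x \<in> A \<inter> (\<Union>j\<in>{..m}. Z j)) (limf G)" by blast
    then have "frequently (\<lambda>x. x \<in> A - (- (\<Union>j\<in>{..m}. Z j))) (limf G)"
      by (rule frequently_subset) blast
    then show ?thesis
      using Zinf[of m] by (intro exI[of _ "- (\<Union>j\<in>{..m}. Z j)"]) simp
  next
    case False
    define W where "W m = (\<Union>j\<in>{..m + j0}. Z j)" for m
    define A' where "A' m = A - W m" for m
    have "\<exists>\<^sub>F n in sequentially. frequently (\<lambda>x. x \<in> A' m) (G n)" for m
    proof -
      have "frequently (\<lambda>x. x \<in> A - A \<inter> W m) (limf G)"
        using frequently_Diff[OF lim.prems(3)] False unfolding W_def by blast
      then have "frequently (\<lambda>x. x \<in> A' m) (limf G)"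
        by (rule frequently_subset) (auto simp: A'_def)
      then show ?thesis by (simp add: frequently_limf)
    qed
    then have "\<forall>k. \<exists>n. k \<le> n \<and> frequently (\<lambda>x. x \<in> A' k) (G n)"
      by (simp add: frequently_sequentially)
    then have "\<exists>i. \<forall>k. k \<le> i k \<and> frequently (\<lambda>x. x \<in> A' k) (G (i k))"
      by (rule choice)
    then obtain i where i: "\<And>k. k \<le> i k" "\<And>k. frequently (\<lambda>x. x \<in> A' k) (G (i k))"
      by blast
    \<comment> \<open>The demand \<open>B j = UNIV\<close> for \<open>j \<le> k\<close> compensates
      for the diagonal set \<open>C\<close> intersecting only over \<open>k < j\<close> on
      \<open>Z j\<close>: it makes \<open>C\<close> smaller than the set given by the k-th
      family.\<close>
    have "\<exists>B. (\<forall>j. eventually (\<lambda>x. x \<in> B j) (K j)) \<and> (\<forall>j\<le>k. B j = UNIV) \<and>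
        frequently (\<lambda>x. x \<in> A' k - (\<Union>j. Z j \<inter> B j)) (G (i k))" for k
    proof (cases "\<exists>j. frequently (\<lambda>x. x \<in> A' k \<inter> Z j) (G (i k))")
      \<comment> \<open>One piece \<open>Z j\<close> carries a positive trace, and
        \<open>A' k\<close> forces \<open>j\<close> beyond \<open>j0\<close>; so the induction
        hypothesis is used with \<open>K j\<close> in place of \<open>H\<close>.\<close>
      case True
      then obtain j where j: "frequently (\<lambda>x. x \<in> A' k \<inter> Z j) (G (i k))" by blast
      have jk: "k + j0 < j"
      proof (rule ccontr)
        assume "\<not> k + j0 < j"
        then have "A' k \<inter> Z j = {}"
          unfolding A'_def W_def by auto
        then show False using j by simp
      qed
      obtain B where B: "eventually (\<lambda>x. x \<in> B) (K j)"
        "frequently (\<lambda>x. x \<in> A' k \<inter> Z j - B) (G (i k))"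
        using lim.IH[OF c(6) rj j] jk by (meson add_leE less_imp_le_nat)
      show ?thesis
      proof (intro exI[of _ "(\<lambda>_. UNIV)(j := B)"] conjI allI impI)
        show "frequently (\<lambda>x. x \<in> A' k - (\<Union>ja. Z ja \<inter> ((\<lambda>_. UNIV)(j := B)) ja)) (G (i k))"
          by (rule frequently_subset[OF B(2)])
            (auto dest: disjoint_family_unique[OF c(5)] split: if_splits)
      qed (use B jk in auto)
    next
      \<comment> \<open>Here the induction hypothesis is used with \<open>H\<close> itself. Every
        single \<open>Z j\<close> is negligible for \<open>G (i k)\<close>, so removing finitely
        many of them afterwards costs nothing.\<close>
      case False
      obtain B where B: "eventually (\<lambda>x. x \<in> B) H" "frequently (\<lambda>x. x \<in> A' k - B) (G (i k))"
        using lim.IH[OF lim.prems(1) less_trans[OF less_strict_sup[of b, OF b] lim.prems(2)] i(2)[of k]]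
        by blast
      obtain N where N: "\<And>n. N \<le> n \<Longrightarrow> eventually (\<lambda>x. x \<in> B) (K n)"
        using B(1) unfolding c(3) eventually_limf eventually_sequentially by blast
      define B' where "B' j = (if j \<le> max N k then UNIV else B)" for j
      have "\<not> frequently (\<lambda>x. x \<in> (\<Union>j\<in>{..max N k}. A' k \<inter> Z j)) (G (i k))"
        using False frequently_UN_finite[of "{..max N k}" "\<lambda>j. A' k \<inter> Z j"] by blast
      then have "frequently (\<lambda>x. x \<in> (A' k - B) - (\<Union>j\<in>{..max N k}. A' k \<inter> Z j)) (G (i k))"
        by (rule frequently_Diff[OF B(2)])
      then have "frequently (\<lambda>x. x \<in> A' k - (\<Union>j. Z j \<inter> B' j)) (G (i k))"
        by (rule frequently_subset) (auto simp: B'_def split: if_splits)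
      then show ?thesis
        using N by (intro exI[of _ B']) (auto simp: B'_def)
    qed
    then obtain B where B: "\<And>k j. eventually (\<lambda>x. x \<in> B k j) (K j)"
        "\<And>k j. j \<le> k \<Longrightarrow> B k j = UNIV"
        "\<And>k. frequently (\<lambda>x. x \<in> A' k - (\<Union>j. Z j \<inter> B k j)) (G (i k))"
      by metis
    define C where "C = (\<Union>j. Z j \<inter> (\<Inter>k\<in>{..<j}. B k j))"
    have "eventually (\<lambda>x. x \<in> C) H"
      unfolding C_def c(3) by (rule eventually_limf_diagonal) (rule c(5) KZ B(1))+
    moreover have "frequently (\<lambda>x. x \<in> A - C) (limf G)"
    proof -
      have "frequently (\<lambda>x. x \<in> A - C) (G (i k))" for k
      proof (rule frequently_subset[OF B(3)])
        have "C \<subseteq> (\<Union>j. Z j \<inter> B k j)"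
        proof
          fix x assume "x \<in> C"
          then obtain j where j: "x \<in> Z j" "\<And>k. k < j \<Longrightarrow> x \<in> B k j"
            unfolding C_def by blast
          then have "x \<in> B k j"
            using B(2)[of j k] by (cases "k < j") auto
          then show "x \<in> (\<Union>j. Z j \<inter> B k j)"
            using j(1) by blast
        qed
        then show "A' k - (\<Union>j. Z j \<inter> B k j) \<subseteq> A - C"
          unfolding A'_def by blast
      qed
      then show ?thesis
        unfolding frequently_limf frequently_sequentially using i(1) by blast
    qed
    ultimately show ?thesis by blast
  qed
qed

text \<open>The k-th piece of \<open>U\<close> is taken from \<open>A k\<close> and is positive for
  the k-th filter, hence for all earlier and coarser ones; so \<open>U\<close> is positive for every
  limit at once. What lies outside \<open>A k\<close> is confined to finitely many pieces.\<close>

lemma limf_fusion: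
  assumes X: "disjoint_family X" and GX: "\<And>n i. eventually (\<lambda>x. x \<in> X i) (G n i)"
    and dec: "\<And>n i. G (Suc n) i \<le> G n i"
    and A: "decseq A" "\<And>n. frequently (\<lambda>x. x \<in> A n) (limf (G n))"
  shows "\<exists>U \<subseteq> A 0. (\<forall>n. frequently (\<lambda>x. x \<in> U) (limf (G n))) \<and>
    (\<forall>k n. \<not> frequently (\<lambda>x. x \<in> U - A k) (limf (G n)))"
proof -
  have dec': "G n i \<le> G m i" if "m \<le> n" for m n i
    using that by (rule lift_Suc_antimono_le[of "\<lambda>n. G n i", OF dec])
  have "\<forall>k. \<exists>i. k \<le> i \<and> frequently (\<lambda>x. x \<in> A k) (G k i)"
    using A(2) by (simp add: frequently_limf frequently_sequentially)
  then have "\<exists>i. \<forall>k. k \<le> i k \<and> frequently (\<lambda>x. x \<in> A k) (G k (i k))"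
    by (rule choice)
  then obtain i where i: "\<And>k. k \<le> i k" "\<And>k. frequently (\<lambda>x. x \<in> A k) (G k (i k))"
    by blast
  define U where "U = (\<Union>k. A k \<inter> X (i k))"
  have "U \<subseteq> A 0"
    unfolding U_def using decseqD[OF A(1)] by blast
  moreover have "frequently (\<lambda>x. x \<in> U) (limf (G n))" for n
  proof -
    have "frequently (\<lambda>x. x \<in> U) (G n (i k))" if "n \<le> k" for k
    proof -
      have "frequently (\<lambda>x. x \<in> A k \<inter> X (i k)) (G k (i k))"
        by (rule frequently_Int[OF i(2) GX])
      then have "frequently (\<lambda>x. x \<in> U) (G k (i k))"
        by (rule frequently_subset) (auto simp: U_def)
      then show ?thesis
        by (rule frequently_filter_mono[OF dec'[OF that]])
    qed
    then show ?thesis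
      unfolding frequently_limf frequently_sequentially using i(1)
      by (meson max.bounded_iff nle_le order_trans)
  qed
  moreover have "\<not> frequently (\<lambda>x. x \<in> U - A k) (limf (G n))" for k n
  proof -
    have "U - A k \<subseteq> (\<Union>m\<in>{..<k}. X (i m))"
    proof
      fix x assume "x \<in> U - A k"
      then obtain m where m: "x \<in> A m" "x \<in> X (i m)" "x \<notin> A k"
        unfolding U_def by blast
      then have "m < k"
        using decseqD[OF A(1), of k m] by (meson not_less subsetD)
      then show "x \<in> (\<Union>m\<in>{..<k}. X (i m))"
        using m(2) by blast
    qed
    moreover have "eventually (\<lambda>x. x \<notin> (\<Union>m\<in>{..<k}. X (i m))) (limf (G n))"
      unfolding eventually_limf eventually_sequentially
    proof (intro exI allI impI)
      fix l assume l: "Suc (Max (i ` {..k})) \<le> l"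
      have "i m < l" if "m < k" for m
      proof -
        have "i m \<le> Max (i ` {..k})"
          using that by (intro Max_ge) auto
        then show ?thesis using l by simp
      qed
      then show "eventually (\<lambda>x. x \<notin> (\<Union>m\<in>{..<k}. X (i m))) (G n l)"
        by (intro eventually_mono[OF GX[of l n]]) (auto dest: disjoint_family_unique[OF X])
    qed
    ultimately have "eventually (\<lambda>x. x \<notin> U - A k) (limf (G n))"
      by (elim eventually_mono) blast
    then show ?thesis
      by (simp add: frequently_def)
  qed
  ultimately show ?thesis by blast
qed

text \<open>One set \<open>B\<close> has to defeat \<open>H\<close> for all \<open>n\<close>
  simultaneously. Each \<open>n\<close> yields its own \<open>B n\<close>; these are diagonalized
  along the pieces of \<open>H\<close>, which requires that what remains of \<open>A\<close> stays
  positive after deleting any finite number of those pieces.\<close>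

lemma contour_on_rank_less_limf:
  assumes X: "disjoint_family X" and GX: "\<And>n i. eventually (\<lambda>x. x \<in> X i) (G n i)"
    and con: "\<And>n. contour_on (b n) (Z n) (limf (G n))" and H: "contour_on c Y H" and bc: "\<And>n. b n < c"
    and A: "\<And>n. frequently (\<lambda>x. x \<in> A) (limf (G n))"
    and mono: "\<And>n. limf (G (Suc n)) \<le> limf (G n)"
  shows "\<exists>B. eventually (\<lambda>x. x \<in> B) H \<and> (\<forall>n. frequently (\<lambda>x. x \<in> A - B) (limf (G n)))"
proof -
  have mono': "limf (G n) \<le> limf (G m)" if "m \<le> n" for m n
    using that by (rule lift_Suc_antimono_le[of "\<lambda>n. limf (G n)", OF mono])
  have c0: "c \<noteq> 0"
    using bc[of 0] by auto
  obtain r V K where c: "c = strict_sup r" "Y = (\<Union>n. V n)" "H = limf K" "mono r"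
    "disjoint_family V" "\<And>n. contour_on (r n) (V n) (K n)" "\<And>n. r n < \<omega>\<^sub>1"
    by (rule contour_on_limE[OF H c0]) (rule that)
  define W where "W m = (\<Union>j\<in>{..m}. V j)" for m
  have KV: "eventually (\<lambda>x. x \<in> V j) (K j)" for j
    by (rule contour_on_eventually[OF c(6)])
  have WH: "eventually (\<lambda>x. x \<notin> W m) H" for m
    unfolding c(3) eventually_limf eventually_sequentially
  proof (intro exI allI impI)
    fix n assume n: "Suc m \<le> n"
    show "eventually (\<lambda>x. x \<notin> W m) (K n)"
      using KV[of n] by (rule eventually_mono)
        (use n in \<open>auto simp: W_def dest: disjoint_family_unique[OF c(5)]\<close>)
  qed
  show ?thesis
  proof (cases "\<exists>m. \<forall>n. frequently (\<lambda>x. x \<in> A \<inter> W m) (limf (G n))")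
    case True
    then obtain m where m: "\<And>n. frequently (\<lambda>x. x \<in> A \<inter> W m) (limf (G n))" by blast
    have "frequently (\<lambda>x. x \<in> A - (- W m)) (limf (G n))" for n
      using m by (rule frequently_subset) blast
    moreover have "eventually (\<lambda>x. x \<in> - W m) H"
      using WH[of m] by simp
    ultimately show ?thesis by blast
  next
    case False
    \<comment> \<open>A set negligible at \<open>n'\<close> is negligible for all finer filters, and
      positivity at the later of \<open>n\<close> and \<open>n'\<close> passes back to
      \<open>n\<close>.\<close>
    have AW: "frequently (\<lambda>x. x \<in> A - W m) (limf (G n))" for m n
    proof -
      obtain n' where n': "\<not> frequently (\<lambda>x. x \<in> A \<inter> W m) (limf (G n'))"
        using False by blast
      have "\<not> frequently (\<lambda>x. x \<in> A \<inter> W m) (limf (G (max n n')))"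
        using n' frequently_filter_mono[OF mono'[of n' "max n n'"]] by auto
      then have "frequently (\<lambda>x. x \<in> A - A \<inter> W m) (limf (G (max n n')))"
        by (rule frequently_Diff[OF A])
      then have "frequently (\<lambda>x. x \<in> A - W m) (limf (G (max n n')))"
        by (rule frequently_subset) blast
      then show ?thesis
        using frequently_filter_mono[OF mono'[of n "max n n'"]] by auto
    qed
    have "\<exists>B. eventually (\<lambda>x. x \<in> B) H \<and> (\<forall>m. frequently (\<lambda>x. x \<in> A - B - W m) (limf (G n)))" for n
    proof -
      \<comment> \<open>Fusion over a constant sequence of filters gives \<open>U\<close> inside
        \<open>A\<close> that meets every \<open>W m\<close> in a negligible set. Hence the positive
        part of \<open>U\<close> outside \<open>B\<close> survives the removal of any
        \<open>W m\<close>.\<close>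
      have "decseq (\<lambda>m. A - W m)"
        unfolding decseq_def W_def by force
      then obtain U where U: "U \<subseteq> A - W 0" "frequently (\<lambda>x. x \<in> U) (limf (G n))"
          "\<And>m. \<not> frequently (\<lambda>x. x \<in> U - (A - W m)) (limf (G n))"
        using limf_fusion[of X "\<lambda>_. G n" "\<lambda>m. A - W m"] X GX AW by auto
      obtain B where B: "eventually (\<lambda>x. x \<in> B) H" "frequently (\<lambda>x. x \<in> U - B) (limf (G n))"
        using contour_on_rank_less[OF con H bc U(2)] by blast
      have "frequently (\<lambda>x. x \<in> A - B - W m) (limf (G n))" for m
        using frequently_Diff[OF B(2) U(3)[of m]] by (rule frequently_subset) blast
      then show ?thesis using B(1) by blast
    qed
    then obtain B where B: "\<And>n. eventually (\<lambda>x. x \<in> B n) H"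
        "\<And>n m. frequently (\<lambda>x. x \<in> A - B n - W m) (limf (G n))"
      by metis
    have "\<exists>N. \<forall>j\<ge>N. eventually (\<lambda>x. x \<in> B n) (K j)" for n
      using B(1)[of n] unfolding c(3) eventually_limf eventually_sequentially by blast
    then obtain N where N: "\<And>n j. N n \<le> j \<Longrightarrow> eventually (\<lambda>x. x \<in> B n) (K j)"
      by metis
    \<comment> \<open>\<open>B n\<close> is known to belong to \<open>K j\<close> only for
      \<open>j\<close> from \<open>N n\<close> on, whence the value \<open>UNIV\<close> before. So
      \<open>D\<close> lies in \<open>B n\<close> up to the finitely many pieces in
      \<open>W (max n (N n))\<close>.\<close>
    define C where "C n j = (if j \<le> N n then UNIV else B n)" for n j
    define D where "D = (\<Union>j. V j \<inter> (\<Inter>k\<in>{..<j}. C k j))"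
    have "eventually (\<lambda>x. x \<in> C n j) (K j)" for n j
      using N[of n j] by (simp add: C_def)
    then have "eventually (\<lambda>x. x \<in> D) H"
      unfolding D_def c(3) by (intro eventually_limf_diagonal c(5) KV)
    moreover have "frequently (\<lambda>x. x \<in> A - D) (limf (G n))" for n
    proof (rule frequently_subset[OF B(2)[of n "max n (N n)"]])
      have "D \<subseteq> W (max n (N n)) \<union> B n"
      proof
        fix x assume "x \<in> D"
        then obtain j where j: "x \<in> V j" "\<And>k. k < j \<Longrightarrow> x \<in> C k j"
          unfolding D_def by blast
        show "x \<in> W (max n (N n)) \<union> B n"
        proof (cases "j \<le> max n (N n)")
          case True
          then show ?thesis using j(1) unfolding W_def by blast
        next
          case False
          then have "n < j" "\<not> j \<le> N n" by auto
          then show ?thesis using j(2)[of n] unfolding C_def by simp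
        qed
      qed
      then show "A - B n - W (max n (N n)) \<subseteq> A - D" by blast
    qed
    ultimately show ?thesis by blast
  qed
qed


section \<open>Ideals and generic ultrafilters\<close>

lemma infinite_imp_frequently_sequentially:
  assumes "infinite K" "\<And>n. n \<in> K \<Longrightarrow> P n"
  shows "\<exists>\<^sub>F n in sequentially. P n"
  using assms unfolding frequently_sequentially infinite_nat_iff_unbounded_le by blast

text \<open>Let \<open>J\<close> absorb all images up to finite sets. Either infinitely many
  \<open>U k\<close> stay positive over \<open>J\<close>, or for almost all \<open>k\<close>
  positivity sits on the finite remainder of the image and therefore on a single fibre.\<close>

lemma P_ideal_union_of_positive:
  fixes f :: "nat \<Rightarrow> nat" and U :: "nat \<Rightarrow> nat set" and G :: "nat \<Rightarrow> nat filter"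
  assumes tall: "is_tall \<I>" and P: "is_P_ideal \<I>" and sing: "\<And>n. {n} \<in> \<I>"
    and U: "\<And>k. frequently (\<lambda>x. x \<in> U k) (G k)" "\<And>k. f ` U k \<in> \<I>"
  shows "\<exists>K V. infinite K \<and> (\<forall>k. V k \<subseteq> U k) \<and> (\<forall>k\<in>K. frequently (\<lambda>x. x \<in> V k) (G k)) \<and>
    f ` (\<Union>k\<in>K. V k) \<in> \<I>"
proof -
  have sub: "B \<in> \<I>" if "A \<in> \<I>" "B \<subseteq> A" for A B
    using P that unfolding is_P_ideal_def is_ideal_def by blast
  obtain J where J: "J \<in> \<I>" "\<And>k. finite (f ` U k - J)"
    using conjunct2[OF P[unfolded is_P_ideal_def], rule_format, of "\<lambda>k. f ` U k"] U(2) by blast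
  define K0 where "K0 = {k. frequently (\<lambda>x. x \<in> U k \<inter> f -` J) (G k)}"
  show ?thesis
  proof (cases "infinite K0")
    case True
    have "f ` (\<Union>k\<in>K0. U k \<inter> f -` J) \<in> \<I>"
      by (rule sub[OF J(1)]) blast
    then show ?thesis
      using True unfolding K0_def by (intro exI[of _ K0] exI[of _ "\<lambda>k. U k \<inter> f -` J"]) (auto simp: K0_def)
  next
    case False
    define K1 where "K1 = - K0"
    have K1: "infinite K1"
      using False unfolding K1_def by (simp add: Compl_eq_Diff_UNIV)
    have "\<exists>j. frequently (\<lambda>x. x \<in> U k \<inter> f -` {j}) (G k)" if "k \<in> K1" for k
    proof -
      have "U k = (U k \<inter> f -` J) \<union> (\<Union>j\<in>f ` U k - J. U k \<inter> f -` {j})"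
        by blast
      then have "frequently (\<lambda>x. x \<in> (U k \<inter> f -` J) \<union> (\<Union>j\<in>f ` U k - J. U k \<inter> f -` {j})) (G k)"
        using U(1)[of k] by simp
      then have "frequently (\<lambda>x. x \<in> (\<Union>j\<in>f ` U k - J. U k \<inter> f -` {j})) (G k)"
        using that unfolding K1_def K0_def frequently_Un by blast
      then show ?thesis
        using frequently_UN_finite[OF J(2)[of k], of "\<lambda>j. U k \<inter> f -` {j}"] by blast
    qed
    then have "\<forall>k\<in>K1. \<exists>j. frequently (\<lambda>x. x \<in> U k \<inter> f -` {j}) (G k)"
      by blast
    then have "\<exists>j. \<forall>k\<in>K1. frequently (\<lambda>x. x \<in> U k \<inter> f -` {j k}) (G k)"
      by (rule bchoice)
    then obtain j where j: "\<And>k. k \<in> K1 \<Longrightarrow> frequently (\<lambda>x. x \<in> U k \<inter> f -` {j k}) (G k)"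
      by blast
    \<comment> \<open>If the values \<open>j k\<close> are finite in number, one is repeated
      infinitely often and its singleton serves; otherwise tallness selects infinitely many of
      them.\<close>
    have "\<exists>K L. infinite K \<and> K \<subseteq> K1 \<and> L \<in> \<I> \<and> j ` K \<subseteq> L"
    proof (cases "finite (j ` K1)")
      case True
      then obtain k0 where "k0 \<in> K1" "infinite {k \<in> K1. j k = j k0}"
        using pigeonhole_infinite[OF K1] by blast
      then show ?thesis
        using sing[of "j k0"] by (intro exI[of _ "{k \<in> K1. j k = j k0}"] exI[of _ "{j k0}"]) auto
    next
      case False
      then obtain L where L: "L \<in> \<I>" "L \<subseteq> j ` K1" "infinite L"
        using tall unfolding is_tall_def by blast
      have "j ` {k \<in> K1. j k \<in> L} = L"
        using L(2) by blast
      then have "infinite {k \<in> K1. j k \<in> L}"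
        using L(3) by (metis finite_imageI)
      then show ?thesis
        using L(1) by (intro exI[of _ "{k \<in> K1. j k \<in> L}"] exI[of _ L]) auto
    qed
    then obtain K L where KL: "infinite K" "K \<subseteq> K1" "L \<in> \<I>" "j ` K \<subseteq> L"
      by blast
    have "f ` (\<Union>k\<in>K. U k \<inter> f -` {j k}) \<in> \<I>"
      by (rule sub[OF KL(3)]) (use KL(4) in blast)
    then show ?thesis
      using KL(1,2) j by (intro exI[of _ K] exI[of _ "\<lambda>k. U k \<inter> f -` {j k}"]) blast
  qed
qed

lemma contour_on_ideal_image:
  fixes f :: "nat \<Rightarrow> nat"
  assumes tall: "is_tall \<I>" and P: "is_P_ideal \<I>" and sing: "\<And>n. {n} \<in> \<I>"
    and "contour_on a X G" "frequently (\<lambda>x. x \<in> A) G"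
  shows "\<exists>U \<subseteq> A. frequently (\<lambda>x. x \<in> U) G \<and> f ` U \<in> \<I>"
  using assms(4,5)
proof (induction rule: contour_on.induct)
  case (point x)
  then have "x \<in> A" "frequently (\<lambda>y. y \<in> {x}) (principal {x})"
    by (auto simp: frequently_def eventually_principal)
  then show ?case
    using sing[of "f x"] by (intro exI[of _ "{x}"]) auto
next
  case (lim a X G)
  obtain k :: "nat \<Rightarrow> nat" where k: "strict_mono k" "\<And>n. frequently (\<lambda>x. x \<in> A) (G (k n))"
    by (rule frequently_sequentially_subseq[OF lim.prems[unfolded frequently_limf]]) (rule that)
  have "\<forall>n. \<exists>U. U \<subseteq> A \<and> frequently (\<lambda>x. x \<in> U) (G (k n)) \<and> f ` U \<in> \<I>"
    using lim.IH k(2) by blast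
  then have "\<exists>U. \<forall>n. U n \<subseteq> A \<and> frequently (\<lambda>x. x \<in> U n) (G (k n)) \<and> f ` U n \<in> \<I>"
    by (rule choice)
  then obtain U where U: "\<And>n. U n \<subseteq> A" "\<And>n. frequently (\<lambda>x. x \<in> U n) (G (k n))" "\<And>n. f ` U n \<in> \<I>"
    by blast
  have "\<exists>K V. infinite K \<and> (\<forall>n. V n \<subseteq> U n) \<and> (\<forall>n\<in>K. frequently (\<lambda>x. x \<in> V n) (G (k n))) \<and>
      f ` (\<Union>n\<in>K. V n) \<in> \<I>"
    by (rule P_ideal_union_of_positive[OF tall P sing U(2,3)])
  then obtain K V where KV: "infinite K" "\<And>n. V n \<subseteq> U n"
      "\<And>n. n \<in> K \<Longrightarrow> frequently (\<lambda>x. x \<in> V n) (G (k n))" "f ` (\<Union>n\<in>K. V n) \<in> \<I>"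
    by (elim exE conjE) blast
  have "infinite (k ` K)"
    using KV(1) finite_image_iff[OF inj_on_subset[OF strict_mono_imp_inj_on[OF k(1)] subset_UNIV]] by blast
  then have "frequently (\<lambda>x. x \<in> (\<Union>n\<in>K. V n)) (limf G)"
    unfolding frequently_limf
  proof (rule infinite_imp_frequently_sequentially)
    fix m assume "m \<in> k ` K"
    then obtain n where "n \<in> K" "m = k n" by blast
    then show "frequently (\<lambda>x. x \<in> (\<Union>n\<in>K. V n)) (G m)"
      using KV(3)[of n] by (auto elim: frequently_elim1)
  qed
  moreover have "(\<Union>n\<in>K. V n) \<subseteq> A"
    using U(1) KV(2) by blast
  ultimately show ?case
    using KV(4) by blast
qed

section \<open>Generic chains of length \<omega>1 and the ultrafilters they generate\<close>

text \<open>A fundamental sequence of a stage \<open>x\<close> picks out countably many earlier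
  conditions cofinal below \<open>x\<close>. Closure bounds them, and density then meets the
  requirement of stage \<open>x\<close>.\<close>

lemma omega_one_generic_chain:
  fixes P :: "'c set" and le :: "'c \<Rightarrow> 'c \<Rightarrow> bool" and D :: "ordinal \<Rightarrow> 'c \<Rightarrow> bool"
  assumes ne: "P \<noteq> {}" and refl: "\<And>p. le p p" and trans: "\<And>p q r. le p q \<Longrightarrow> le q r \<Longrightarrow> le p r"
    and closed: "\<And>s :: nat \<Rightarrow> 'c. (\<And>n. s n \<in> P) \<Longrightarrow> (\<And>n. le (s (Suc n)) (s n)) \<Longrightarrow> \<exists>p\<in>P. \<forall>n. le p (s n)"
    and dense: "\<And>a p. a < \<omega>\<^sub>1 \<Longrightarrow> p \<in> P \<Longrightarrow> \<exists>q\<in>P. le q p \<and> D a q"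
  shows "\<exists>c. \<forall>a < \<omega>\<^sub>1. c a \<in> P \<and> D a (c a) \<and> (\<forall>b<a. le (c a) (c b))"
proof -
  let ?R = "{(x, y :: ordinal). x < y}"
  let ?Q = "\<lambda>f x r. x < \<omega>\<^sub>1 \<longrightarrow> r \<in> P \<and> D x r \<and> (\<forall>y<x. le r (f y))"
  have "\<exists>f. \<forall>x. ?Q f x (f x)"
  proof (rule dependent_wf_choice)
    show "wf ?R" by (rule wf)
    show "?Q f x r = ?Q g x r" if "\<And>z. (z, x) \<in> ?R \<Longrightarrow> f z = g z" for f g :: "ordinal \<Rightarrow> 'c" and x r
      using that by auto
    fix x and f :: "ordinal \<Rightarrow> 'c"
    assume IH: "\<And>y. (y, x) \<in> ?R \<Longrightarrow> ?Q f y (f y)"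
    show "\<exists>r. ?Q f x r"
    proof (cases "x < \<omega>\<^sub>1")
      case True
      have "\<exists>p\<in>P. \<forall>y<x. le p (f y)"
      proof (cases "x = 0")
        case False
        then obtain a where a: "mono a" "\<And>n. a n < \<omega>\<^sub>1" "strict_sup a = x"
          using ordinal_fundamental_sequence[of x] True one_le_ordinal_iff by blast
        have ax: "a n < x" for n
          using less_strict_sup[of a] a by blast
        have "\<exists>p\<in>P. \<forall>n. le p (f (a n))"
        proof (rule closed)
          show "f (a n) \<in> P" for n
            using IH[of "a n"] ax a(2) by simp
          \<comment> \<open>Fundamental sequences may repeat values, as they must for a successor
            stage; reflexivity covers this.\<close>
          show "le (f (a (Suc n))) (f (a n))" for n
          proof (cases "a (Suc n) = a n")
            case False
            then have "a n < a (Suc n)"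
              using monoD[OF a(1), of n "Suc n"] by simp
            then show ?thesis
              using IH[of "a (Suc n)"] ax a(2) by simp
          qed (simp add: refl)
        qed
        then obtain p where p: "p \<in> P" "\<And>n. le p (f (a n))" by blast
        have "le p (f y)" if y: "y < x" for y
        proof -
          obtain n where n: "y \<le> a n"
            using less_strict_sup_iff[of a y, OF a(2)] a(3) y by blast
          show ?thesis
          proof (cases "y = a n")
            case False
            then have "le (f (a n)) (f y)"
              using IH[of "a n"] ax a(2) n by simp
            then show ?thesis
              using p(2) trans by blast
          qed (simp add: p)
        qed
        then show ?thesis using p(1) by blast
      qed (use ne in auto)
      then obtain p where p: "p \<in> P" "\<And>y. y < x \<Longrightarrow> le p (f y)" by blast
      obtain q where "q \<in> P" "le q p" "D x q"
        using dense[OF True p(1)] by blast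
      then show ?thesis
        using p(2) trans by blast
    qed simp
  qed
  then show ?thesis by blast
qed

text \<open>Graphs coded as sets of numbers let one enumeration of all sets list all functions
  too.\<close>

definition function_code :: "(nat \<Rightarrow> nat) \<Rightarrow> nat set" where
  "function_code f = {prod_encode (n, f n) | n. True}"

lemma inj_function_code: "inj function_code"
proof (rule injI, rule ext)
  fix f g :: "nat \<Rightarrow> nat" and n assume "function_code f = function_code g"
  moreover have "prod_encode (n, f n) \<in> function_code f"
    by (auto simp: function_code_def)
  ultimately have "prod_encode (n, f n) \<in> function_code g"
    by simp
  then show "f n = g n"
    by (auto simp: function_code_def)
qed

text \<open>Stage \<open>a\<close> decides the set \<open>e a\<close>, treats the function coded by
  \<open>e a\<close> and meets \<open>E a\<close>. Along the chain the filters \<open>\<Phi>\<close>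
  are linearly ordered and proper, so their common refinement is proper.\<close>

lemma generic_ideal_ultrafilter:
  fixes P :: "'c set" and le :: "'c \<Rightarrow> 'c \<Rightarrow> bool" and \<Phi> :: "'c \<Rightarrow> nat filter"
  assumes CH: continuum_hypothesis
    and ne: "P \<noteq> {}" and refl: "\<And>p. le p p" and trans: "\<And>p q r. le p q \<Longrightarrow> le q r \<Longrightarrow> le p r"
    and closed: "\<And>s :: nat \<Rightarrow> 'c. (\<And>n. s n \<in> P) \<Longrightarrow> (\<And>n. le (s (Suc n)) (s n)) \<Longrightarrow> \<exists>p\<in>P. \<forall>n. le p (s n)"
    and mono: "\<And>p q. le p q \<Longrightarrow> \<Phi> p \<le> \<Phi> q" and proper: "\<And>p. p \<in> P \<Longrightarrow> \<Phi> p \<noteq> bot"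
    and decide: "\<And>p A. p \<in> P \<Longrightarrow> \<exists>q\<in>P. le q p \<and> (eventually (\<lambda>x. x \<in> A) (\<Phi> q) \<or> eventually (\<lambda>x. x \<in> - A) (\<Phi> q))"
    and ideal: "\<And>p f. p \<in> P \<Longrightarrow> \<exists>q\<in>P. le q p \<and> (\<exists>U. eventually (\<lambda>x. x \<in> U) (\<Phi> q) \<and> f ` U \<in> \<I>)"
    and dense: "\<And>p a. p \<in> P \<Longrightarrow> a < \<omega>\<^sub>1 \<Longrightarrow> \<exists>q\<in>P. le q p \<and> E a q"
  shows "\<exists>u. ideal_ultrafilter \<I> u \<and> (\<forall>a<\<omega>\<^sub>1. \<exists>p\<in>P. E a p \<and> u \<le> \<Phi> p)"
proof -
  obtain e where e: "e ` {..<\<omega>\<^sub>1} = (UNIV :: nat set set)"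
    by (rule continuum_hypothesis_enum[OF CH])
  let ?dec = "\<lambda>a F. eventually (\<lambda>x. x \<in> e a) F \<or> eventually (\<lambda>x. x \<in> - e a) F"
  \<comment> \<open>For a set that codes no function, \<open>inv\<close> returns some function,
    which merely adds a harmless requirement.\<close>
  let ?idl = "\<lambda>a F. \<exists>U. eventually (\<lambda>x. x \<in> U) F \<and> inv function_code (e a) ` U \<in> \<I>"
  let ?D = "\<lambda>a p. ?dec a (\<Phi> p) \<and> ?idl a (\<Phi> p) \<and> E a p"
  have "\<exists>q\<in>P. le q p \<and> ?D a q" if a: "a < \<omega>\<^sub>1" and p: "p \<in> P" for a p
  proof -
    obtain q1 where q1: "q1 \<in> P" "le q1 p" "?dec a (\<Phi> q1)"
      using decide[OF p] by blast
    obtain q2 where q2: "q2 \<in> P" "le q2 q1" "?idl a (\<Phi> q2)"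
      using ideal[OF q1(1)] by blast
    obtain q3 where q3: "q3 \<in> P" "le q3 q2" "E a q3"
      using dense[OF q2(1) a] by blast
    have "?dec a (\<Phi> q3)"
      using q1(3) mono[OF q3(2)] mono[OF q2(2)] filter_leD by blast
    moreover have "?idl a (\<Phi> q3)"
      using q2(3) mono[OF q3(2)] filter_leD by blast
    ultimately show ?thesis
      using q1(2) q2(2) q3 trans by blast
  qed
  then have "\<exists>c. \<forall>a < \<omega>\<^sub>1. c a \<in> P \<and> ?D a (c a) \<and> (\<forall>b<a. le (c a) (c b))"
  proof (intro omega_one_generic_chain)
    show "le p r" if "le p q" "le q r" for p q r
      using that by (rule trans)
    show "\<exists>p\<in>P. \<forall>n. le p (s n)" if "\<And>n. s n \<in> P" "\<And>n. le (s (Suc n)) (s n)" for s :: "nat \<Rightarrow> 'c"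
      using that by (rule closed)
  qed (use ne refl in blast)+
  then obtain c where c: "\<And>a. a < \<omega>\<^sub>1 \<Longrightarrow> c a \<in> P" "\<And>a. a < \<omega>\<^sub>1 \<Longrightarrow> ?D a (c a)"
      "\<And>a b. a < \<omega>\<^sub>1 \<Longrightarrow> b < a \<Longrightarrow> le (c a) (c b)"
    by (elim exE) blast
  define u where "u = (INF a\<in>{..<\<omega>\<^sub>1}. \<Phi> (c a))"
  have u_le: "u \<le> \<Phi> (c a)" if "a < \<omega>\<^sub>1" for a
    unfolding u_def using that by (intro INF_lower) simp
  have zero: "0 < \<omega>\<^sub>1"
    using one_less_omega_one zero_ordinal_le le_less_trans by blast
  have "eventually (\<lambda>_. False) u \<longleftrightarrow> (\<exists>a\<in>{..<\<omega>\<^sub>1}. eventually (\<lambda>_. False) (\<Phi> (c a)))"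
    unfolding u_def
  proof (rule eventually_INF_base)
    fix a b assume "a \<in> {..<\<omega>\<^sub>1}" "b \<in> {..<\<omega>\<^sub>1}"
    moreover have le: "\<Phi> (c a) \<le> \<Phi> (c b)" if "b \<le> a" "a < \<omega>\<^sub>1" for a b
      using that mono[OF c(3)[of a b]] by (cases "a = b") auto
    ultimately show "\<exists>x\<in>{..<\<omega>\<^sub>1}. \<Phi> (c x) \<le> inf (\<Phi> (c a)) (\<Phi> (c b))"
      by (intro bexI[of _ "max a b"]) (auto intro: le)
  qed (use zero in blast)
  then have "u \<noteq> bot"
    using c(1) proper by (auto simp: trivial_limit_def)
  moreover have "eventually (\<lambda>x. x \<in> A) u \<or> eventually (\<lambda>x. x \<in> - A) u" for A
  proof -
    have "A \<in> e ` {..<\<omega>\<^sub>1}"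
      unfolding e by simp
    then obtain a where "a < \<omega>\<^sub>1" "A = e a"
      by blast
    then show ?thesis
      using c(2)[of a] filter_leD[OF u_le[of a]] by blast
  qed
  moreover have "\<exists>U. eventually (\<lambda>n. n \<in> U) u \<and> f ` U \<in> \<I>" for f
  proof -
    have "function_code f \<in> e ` {..<\<omega>\<^sub>1}"
      unfolding e by simp
    then obtain a where a: "a < \<omega>\<^sub>1" "function_code f = e a"
      by blast
    then have "inv function_code (e a) = f"
      using inv_f_f[OF inj_function_code, of f] by simp
    then show ?thesis
      using c(2)[of a] filter_leD[OF u_le[of a]] a(1) by auto
  qed
  ultimately have "ideal_ultrafilter \<I> u"
    unfolding ideal_ultrafilter_def ultrafilter_def by blast
  then show ?thesis
    using c(1,2) u_le by blast
qed


section \<open>Contours of cascades\<close>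

lemma succsD:
  assumes "w \<in> succs V v"
  shows "(v, w) \<in> V" "w \<noteq> v" "v \<in> Field V" "w \<in> Field V"
  using assms by (auto simp: succs_def aboveS_def Field_def)

lemma eventually_contour_at_iff:
  assumes "cascade V" "v \<notin> max_elems V"
  shows "eventually P (contour_at V v) \<longleftrightarrow> finite {w \<in> succs V v. \<not> eventually P (contour_at V w)}"
proof
  assume "eventually P (contour_at V v)"
  then obtain G where "G \<subseteq> succs V v" "finite (succs V v - G)" "\<forall>w\<in>G. eventually P (contour_at V w)"
    using eventually_contour_at[OF assms] by blast
  then show "finite {w \<in> succs V v. \<not> eventually P (contour_at V w)}"
    by (elim rev_finite_subset) blast
next
  assume fin: "finite {w \<in> succs V v. \<not> eventually P (contour_at V w)}"
  have "succs V v - {w \<in> succs V v. eventually P (contour_at V w)} =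
      {w \<in> succs V v. \<not> eventually P (contour_at V w)}"
    by blast
  then show "eventually P (contour_at V v)"
    unfolding eventually_contour_at[OF assms]
    using fin by (intro exI[of _ "{w \<in> succs V v. eventually P (contour_at V w)}"]) auto
qed

text \<open>Cofiniteness does not depend on the enumeration, so \<open>e\<close> may be the one with
  monotone ranks.\<close>

lemma contour_at_eq_limf:
  assumes "cascade V" "v \<notin> max_elems V" and e: "bij_betw e UNIV (succs V v)"
  shows "contour_at V v = limf (\<lambda>n. contour_at V (e n))"
proof (rule filter_eqI)
  fix P
  have inj: "inj e" and ran: "succs V v = range e"
    using bij_betw_imp_inj_on[OF e] bij_betw_imp_surj_on[OF e] by simp_all
  have "{w \<in> succs V v. \<not> eventually P (contour_at V w)} = e ` {n. \<not> eventually P (contour_at V (e n))}"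
    unfolding ran by blast
  then show "eventually P (contour_at V v) \<longleftrightarrow> eventually P (limf (\<lambda>n. contour_at V (e n)))"
    unfolding eventually_contour_at_iff[OF assms(1,2)] eventually_limf
    using finite_image_iff[OF inj_on_subset[OF inj subset_UNIV]]
    by (simp add: eventually_cofinite flip: cofinite_eq_sequentially)
qed

lemma rank_at_eq_strict_sup:
  assumes "cascade V" "v \<notin> max_elems V" and e: "bij_betw e UNIV (succs V v)"
  shows "rank_at V v = strict_sup (\<lambda>n. rank_at V (e n))"
proof -
  have "succs V v = range e"
    using bij_betw_imp_surj_on[OF e] by simp
  then show ?thesis
    unfolding rank_at_rec[OF assms(1), of v] strict_sup_def using assms(2) by simp
qed

lemma cascade_order:
  assumes "cascade V"
  shows "trans V" "antisym V" "v \<in> Field V \<Longrightarrow> (v, v) \<in> V"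
  using assms by (auto simp: cascade_def tree_def order_on_defs refl_on_def)

lemma is_least_cascade_root:
  assumes "cascade V"
  shows "is_least V (cascade_root V)"
proof -
  obtain b where b: "is_least V b"
    using assms by (auto simp: cascade_def)
  then have "b' = b" if "is_least V b'" for b'
    using that cascade_order(2)[OF assms] by (auto simp: is_least_def dest: antisymD)
  then show ?thesis
    unfolding cascade_root_def using b by (metis theI)
qed

lemma cascade_root_eq:
  assumes "cascade V" "is_least V b"
  shows "cascade_root V = b"
  using is_least_cascade_root[OF assms(1)] assms(2) cascade_order(2)[OF assms(1)]
  by (auto simp: is_least_def dest: antisymD)

text \<open>Vertices below \<open>m\<close> are comparable, and comparable immediate successors of
  \<open>v\<close> coincide by minimality. This gives disjoint carriers above different
  successors.\<close>

lemma cascade_succs_unique: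
  assumes V: "cascade V" and w: "w \<in> succs V v" "w' \<in> succs V v" and m: "(w, m) \<in> V" "(w', m) \<in> V"
  shows "w = w'"
proof -
  have "m \<in> Field V"
    using m by (auto simp: Field_def)
  then have "well_order_on (under V m) (Restr V (under V m))"
    using V by (auto simp: cascade_def tree_def)
  then have "total_on (under V m) (Restr V (under V m))"
    by (auto simp: order_on_defs)
  then have "w = w' \<or> (w, w') \<in> V \<or> (w', w) \<in> V"
    using m by (auto simp: total_on_def under_def)
  then show ?thesis
    using w by (auto simp: succs_def)
qed

text \<open>Well-founded induction from the maximal elements downwards. An inclusion for the carrier
  is enough to make the carriers above distinct successors disjoint.\<close>

lemma contour_on_contour_at:
  assumes V: "cascade V" "sequential V" "monotone_cascade V" and l: "inj_on l (max_elems V)"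
    and "v \<in> Field V"
  shows "\<exists>X \<subseteq> l ` {m \<in> max_elems V. (v, m) \<in> V}. contour_on (rank_at V v) X (filtermap l (contour_at V v))"
  using wf_succ_rel[OF V(1)] assms(5)
proof (induction v rule: wf_induct_rule)
  case (less v)
  show ?case
  proof (cases "v \<in> max_elems V")
    case True
    then have "{l v} \<subseteq> l ` {m \<in> max_elems V. (v, m) \<in> V}"
      using cascade_order(3)[OF V(1) less.prems] by blast
    moreover have "rank_at V v = 0" "filtermap l (contour_at V v) = principal {l v}"
      using True by (simp_all add: rank_at_rec[OF V(1), of v] contour_at_rec[OF V(1), of v])
    ultimately show ?thesis
      using contour_on.point[of "l v"] by (intro exI[of _ "{l v}"]) simp
  next
    case False
    then obtain e :: "nat \<Rightarrow> _" where e: "bij_betw e UNIV (succs V v)" "mono (\<lambda>n. rank_at V (e n))"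
      using V(3) less.prems unfolding monotone_cascade_def by blast
    have es: "e n \<in> succs V v" for n
      using e(1) by (auto simp: bij_betw_def)
    have "\<forall>n. \<exists>X. X \<subseteq> l ` {m \<in> max_elems V. (e n, m) \<in> V} \<and>
        contour_on (rank_at V (e n)) X (filtermap l (contour_at V (e n)))"
    proof
      fix n
      have "(e n, v) \<in> succ_rel V"
        using es by (simp add: succ_rel_def)
      then show "\<exists>X. X \<subseteq> l ` {m \<in> max_elems V. (e n, m) \<in> V} \<and>
          contour_on (rank_at V (e n)) X (filtermap l (contour_at V (e n)))"
        using less.IH succsD(4)[OF es] by blast
    qed
    from choice[OF this] obtain X where X: "\<And>n. X n \<subseteq> l ` {m \<in> max_elems V. (e n, m) \<in> V}"
      "\<And>n. contour_on (rank_at V (e n)) (X n) (filtermap l (contour_at V (e n)))"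
      by blast
    have "disjoint_family X"
      unfolding disjoint_family_on_def
    proof (intro ballI impI)
      fix i j :: nat assume "i \<noteq> j"
      have False if x: "x \<in> X i" "x \<in> X j" for x
      proof -
        obtain m where m: "m \<in> max_elems V" "(e i, m) \<in> V" "x = l m"
          using X(1) x(1) by blast
        obtain m' where m': "m' \<in> max_elems V" "(e j, m') \<in> V" "x = l m'"
          using X(1) x(2) by blast
        have "m = m'"
          using l m m' by (auto dest: inj_onD)
        then have "e i = e j"
          using cascade_succs_unique[OF V(1) es es m(2)] m'(2) by blast
        then show False
          using bij_betw_imp_inj_on[OF e(1)] \<open>i \<noteq> j\<close> by (auto dest: injD)
      qed
      then show "X i \<inter> X j = {}" by blast
    qed
    then have "contour_on (rank_at V v) (\<Union>n. X n) (filtermap l (contour_at V v))"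
      using contour_on.lim[OF X(2) e(2)]
      unfolding rank_at_eq_strict_sup[OF V(1) False e(1)] contour_at_eq_limf[OF V(1) False e(1)] filtermap_limf
      by blast
    moreover have "(\<Union>n. X n) \<subseteq> l ` {m \<in> max_elems V. (v, m) \<in> V}"
    proof (rule UN_least)
      fix n
      have "{m \<in> max_elems V. (e n, m) \<in> V} \<subseteq> {m \<in> max_elems V. (v, m) \<in> V}"
        using succsD(1)[OF es] cascade_order(1)[OF V(1)] by (auto dest: transD)
      then show "X n \<subseteq> l ` {m \<in> max_elems V. (v, m) \<in> V}"
        using X(1)[of n] by blast
    qed
    ultimately show ?thesis by blast
  qed
qed

lemma ms_contours_imp_contour_on:
  assumes "F \<in> ms_contours a"
  shows "\<exists>X. contour_on a X F"
proof -
  obtain V :: "nat rel" and l :: "nat \<Rightarrow> nat" where V: "F = filtermap l (contour V)" "cascade V" "sequential V" "monotone_cascade V"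
    "cascade_rank V = a" "inj_on l (max_elems V)"
    using assms unfolding ms_contours_def by blast
  have "cascade_root V \<in> Field V"
    using is_least_cascade_root[OF V(2)] by (simp add: is_least_def)
  then show ?thesis
    using contour_on_contour_at[OF V(2,3,4,6)] V(1,5) unfolding contour_def cascade_rank_def by blast
qed

section \<open>Joining countably many cascades under a new root\<close>

text \<open>The pairing separates the copies of the cascades, and \<open>Suc\<close> keeps 0 free
  for the new root.\<close>

definition vertex :: "nat \<Rightarrow> nat \<Rightarrow> nat" where
  "vertex n v = Suc (prod_encode (n, v))"

lemma vertex_simps [simp]: "vertex n v \<noteq> 0" "0 < vertex n v" "0 \<noteq> vertex n v" "vertex n v = vertex m w \<longleftrightarrow> n = m \<and> v = w"
  by (auto simp: vertex_def)

lemma inj_vertex: "inj_on (vertex n) A"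
  by (auto simp: inj_on_def)

lemma vertex_cases [case_names zero vertex]:
  obtains "x = 0" | n v where "x = vertex n v"
  by (metis vertex_def not0_implies_Suc prod_decode_inverse surj_pair)

definition joined :: "(nat \<Rightarrow> nat rel) \<Rightarrow> nat rel" where
  "joined V = {(0, 0)} \<union> {(0, vertex n v) | n v. v \<in> Field (V n)} \<union>
     {(vertex n v, vertex n w) | n v w. (v, w) \<in> V n}"

lemma joined_simps [simp]:
  "(0, 0) \<in> joined V" "(x, 0) \<in> joined V \<longleftrightarrow> x = 0"
  "(0, vertex n v) \<in> joined V \<longleftrightarrow> v \<in> Field (V n)"
  "(vertex m v, vertex n w) \<in> joined V \<longleftrightarrow> m = n \<and> (v, w) \<in> V n"
  by (auto simp: joined_def)

lemma joined_vertexE: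
  assumes "(vertex n v, x) \<in> joined V"
  obtains w where "x = vertex n w" "(v, w) \<in> V n"
  using assms by (auto simp: joined_def)

lemma Field_joined: "x \<in> Field (joined V) \<longleftrightarrow> x = 0 \<or> (\<exists>n. \<exists>v\<in>Field (V n). x = vertex n v)"
proof (cases x rule: vertex_cases)
  case zero
  then show ?thesis by (auto simp: Field_def intro: joined_simps)
next
  case (vertex n v)
  have "v \<in> Field (V n)" if "x \<in> Field (joined V)"
    using that unfolding Field_def joined_def vertex by auto
  moreover have "x \<in> Field (joined V)" if "v \<in> Field (V n)"
    using that unfolding vertex by (intro FieldI2[of 0]) simp
  ultimately show ?thesis
    unfolding vertex by auto
qed

context
  fixes V :: "nat \<Rightarrow> nat rel"
  assumes V: "\<And>n. cascade (V n)"
begin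

lemma Partial_order_joined: "Partial_order (joined V)"
proof -
  have "(x, x) \<in> joined V" if "x \<in> Field (joined V)" for x
    using that cascade_order(3)[OF V] by (auto simp: Field_joined)
  moreover have "trans (joined V)"
  proof (rule transI)
    fix x y z assume xy: "(x, y) \<in> joined V" and yz: "(y, z) \<in> joined V"
    show "(x, z) \<in> joined V"
    proof (cases y rule: vertex_cases)
      case zero
      then show ?thesis using xy yz by simp
    next
      case (vertex n v)
      then obtain w where z: "z = vertex n w" "(v, w) \<in> V n"
        using yz joined_vertexE by blast
      show ?thesis
      proof (cases x rule: vertex_cases)
        case zero
        then show ?thesis using z by (auto simp: Field_def)
      next
        case (vertex m u)
        then show ?thesis
          using xy z \<open>y = vertex n v\<close> cascade_order(1)[OF V, of n] by (auto dest: transD)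
      qed
    qed
  qed
  moreover have "antisym (joined V)"
  proof (rule antisymI)
    fix x y assume xy: "(x, y) \<in> joined V" "(y, x) \<in> joined V"
    then show "x = y"
      using cascade_order(2)[OF V] 
      by (cases x rule: vertex_cases; cases y rule: vertex_cases) (auto dest: antisymD)
  qed
  ultimately show ?thesis
    by (auto simp: order_on_defs refl_on_def Field_def)
qed

lemma under_joined: "v \<in> Field (V n) \<Longrightarrow> under (joined V) (vertex n v) = insert 0 (vertex n ` under (V n) v)"
  unfolding under_def
  by (rule set_eqI, rename_tac x, case_tac x rule: vertex_cases) auto

lemma tree_joined: "tree (joined V)"
  unfolding tree_def
proof (intro conjI ballI)
  fix x assume x: "x \<in> Field (joined V)"
  have lin: "Refl (Restr (joined V) A)" "trans (Restr (joined V) A)" "antisym (Restr (joined V) A)"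
    "A \<subseteq> Field (joined V) \<Longrightarrow> refl_on A (Restr (joined V) A)" for A
    using Partial_order_joined by (auto simp: order_on_defs refl_on_def antisym_def trans_Restr Field_def)
  show "well_order_on (under (joined V) x) (Restr (joined V) (under (joined V) x))"
  proof (cases x rule: vertex_cases)
    case zero
    have "Restr (joined V) (under (joined V) x) = {(0, 0)}" "under (joined V) x = {0}"
      unfolding zero by (auto simp: under_def)
    then show ?thesis
      by (auto simp: order_on_defs refl_on_def trans_def antisym_def total_on_def)
  next
    case (vertex n v)
    then have v: "v \<in> Field (V n)"
      using x by (auto simp: Field_joined)
    let ?A = "under (V n) v" and ?B = "insert 0 (vertex n ` under (V n) v)"
    have wo: "well_order_on ?A (Restr (V n) ?A)"
      using V[of n] v by (auto simp: cascade_def tree_def)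
    have AF: "?A \<subseteq> Field (V n)"
      by (auto simp: under_def Field_def)
    \<comment> \<open>The strict order splits into the edges from the root and a copy of the strict
      order of \<open>V n\<close>. No pair of the copy ends in 0, which makes the union of the two
      well-founded.\<close>
    have eq: "Restr (joined V) ?B - Id = {0} \<times> vertex n ` ?A \<union> map_prod (vertex n) (vertex n) ` (Restr (V n) ?A - Id)"
      (is "?L = ?R")
    proof (rule set_eqI)
      fix p :: "nat \<times> nat"
      obtain a b :: nat where p: "p = (a, b)" by (cases p)
      show "p \<in> ?L \<longleftrightarrow> p \<in> ?R"
        unfolding p using AF
        by (cases a rule: vertex_cases; cases b rule: vertex_cases) (auto simp: map_prod_def)
    qed
    have "wf ({0} \<times> vertex n ` ?A \<union> map_prod (vertex n) (vertex n) ` (Restr (V n) ?A - Id))"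
    proof (rule wf_Un)
      show "wf ({0} \<times> vertex n ` ?A)"
        by (rule wf_subset[OF wf_less]) auto
      show "wf (map_prod (vertex n) (vertex n) ` (Restr (V n) ?A - Id))"
        using wo by (intro wf_map_prod_image inj_vertex) (auto simp: well_order_on_def)
    qed auto
    then have wf: "wf (Restr (joined V) ?B - Id)"
      unfolding eq .
    have total: "total_on ?B (Restr (joined V) ?B)"
      using wo AF by (auto simp: order_on_defs total_on_def)
    have "?B \<subseteq> Field (joined V)"
      using AF by (auto simp: Field_joined)
    from lin(4)[OF this] have refl: "refl_on ?B (Restr (joined V) ?B)" .
    show ?thesis
      unfolding vertex under_joined[OF v] order_on_defs
      by (intro conjI refl lin(2,3) total wf) (rule Int_lower2)
  qed
qed (rule Partial_order_joined)

text \<open>Vertices of different copies are incomparable, so apart from the root a branch stays in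
  one copy and is a branch there.\<close>

lemma finite_branch_joined:
  assumes "branch (joined V) C"
  shows "finite C"
proof (cases "C \<subseteq> {0}")
  case True
  then show ?thesis by (rule finite_subset) simp
next
  case False
  then obtain n v where v: "vertex n v \<in> C"
    by (metis insertI1 subsetI vertex_cases)
  have C: "C \<in> Chains (joined V)" and max: "\<And>D. D \<in> Chains (joined V) \<Longrightarrow> C \<subseteq> D \<Longrightarrow> D = C"
    using assms by (auto simp: branch_def)
  define D where "D = {w. vertex n w \<in> C}"
  have CD: "C \<subseteq> insert 0 (vertex n ` D)"
  proof
    fix x assume x: "x \<in> C"
    show "x \<in> insert 0 (vertex n ` D)"
    proof (cases x rule: vertex_cases)
      case (vertex m w)
      have "(x, vertex n v) \<in> joined V \<or> (vertex n v, x) \<in> joined V"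
        using C x v by (auto simp: Chains_def)
      then have "m = n"
        unfolding vertex by auto
      then show ?thesis
        using x vertex by (auto simp: D_def)
    qed simp
  qed
  have "branch (V n) D"
    unfolding branch_def
  proof (intro conjI ballI impI)
    show "D \<in> Chains (V n)"
      using C unfolding Chains_def D_def by force
    fix D' assume D': "D' \<in> Chains (V n)" "D \<subseteq> D'"
    have "w \<in> Field (V n)" if "w \<in> D'" for w
      using that D'(1) unfolding Chains_def Field_def by blast
    then have "insert 0 (vertex n ` D') \<in> Chains (joined V)"
      using D'(1) unfolding Chains_def by auto
    moreover have "C \<subseteq> insert 0 (vertex n ` D')"
      using CD D'(2) by blast
    ultimately have "insert 0 (vertex n ` D') = C"
      by (rule max)
    then show "D' = D"
      unfolding D_def by auto
  qed
  then have "finite D"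
    using V[of n] by (auto simp: cascade_def)
  then show ?thesis
    using CD by (meson finite_imageI finite_insert finite_subset)
qed

lemma is_least_joined: "is_least (joined V) 0"
  by (auto simp: is_least_def Field_joined)

lemma cascade_joined: "cascade (joined V)"
  unfolding cascade_def using tree_joined finite_branch_joined is_least_joined by blast

lemma aboveS_joined: "aboveS (joined V) (vertex n v) = vertex n ` aboveS (V n) v"
  unfolding aboveS_def
  by (rule set_eqI, rename_tac x, case_tac x rule: vertex_cases) (auto elim: joined_vertexE)

lemma aboveS_joined_root: "aboveS (joined V) 0 = (\<Union>n. vertex n ` Field (V n))"
  unfolding aboveS_def
  by (rule set_eqI, rename_tac x, case_tac x rule: vertex_cases) auto

lemma root_Field: "cascade_root (V n) \<in> Field (V n)"
  using is_least_cascade_root[OF V] by (auto simp: is_least_def)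

lemma max_elems_joined:
  "0 \<notin> max_elems (joined V)" "vertex n v \<in> max_elems (joined V) \<longleftrightarrow> v \<in> max_elems (V n)"
  using root_Field by (auto simp: max_elems_def aboveS_joined aboveS_joined_root Field_joined)

lemma succs_joined: "succs (joined V) (vertex n v) = vertex n ` succs (V n) v"
  by (auto simp: succs_def aboveS_joined)

lemma succs_joined_root: "succs (joined V) 0 = range (\<lambda>n. vertex n (cascade_root (V n)))"
proof -
  have least: "(cascade_root (V n), v) \<in> V n" if "v \<in> Field (V n)" for n v
    using is_least_cascade_root[OF V] that by (auto simp: is_least_def)
  have root: "v = cascade_root (V n)" if "(v, cascade_root (V n)) \<in> V n" for n v
    using that least[of v n] cascade_order(2)[OF V, of n] by (auto simp: Field_def dest: antisymD)
  show ?thesis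
  proof (intro subset_antisym subsetI)
    fix x assume x: "x \<in> succs (joined V) 0"
    then obtain n v where v: "x = vertex n v" "v \<in> Field (V n)"
      by (auto simp: succs_def aboveS_joined_root)
    then have "vertex n (cascade_root (V n)) = x"
      using x least[OF v(2)] root_Field[of n] by (auto simp: succs_def aboveS_joined_root)
    then show "x \<in> range (\<lambda>n. vertex n (cascade_root (V n)))"
      by blast
  next
    fix x assume "x \<in> range (\<lambda>n. vertex n (cascade_root (V n)))"
    then obtain n where "x = vertex n (cascade_root (V n))" by blast
    then show "x \<in> succs (joined V) 0"
      using root_Field root by (auto simp: succs_def aboveS_joined_root)
  qed
qed

lemma rank_at_joined: "rank_at (joined V) (vertex n v) = rank_at (V n) v"
  using wf_succ_rel[OF V[of n]]
proof (induction v rule: wf_induct_rule)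
  case (less v)
  then have "rank_at (joined V) (vertex n w) = rank_at (V n) w" if "w \<in> succs (V n) v" for w
    using that by (auto simp: succ_rel_def)
  then show ?case
    unfolding rank_at_rec[OF cascade_joined, of "vertex n v"] rank_at_rec[OF V, of n v]
    by (simp add: max_elems_joined succs_joined)
qed

lemma contour_at_joined: "contour_at (joined V) (vertex n v) = filtermap (vertex n) (contour_at (V n) v)"
  using wf_succ_rel[OF V[of n]]
proof (induction v rule: wf_induct_rule)
  case (less v)
  then have IH: "contour_at (joined V) (vertex n w) = filtermap (vertex n) (contour_at (V n) w)"
    if "w \<in> succs (V n) v" for w
    using that by (auto simp: succ_rel_def)
  show ?case
  proof (cases "v \<in> max_elems (V n)")
    case True
    then show ?thesis
      unfolding contour_at_rec[OF cascade_joined, of "vertex n v"] contour_at_rec[OF V, of n v]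
      by (simp add: max_elems_joined)
  next
    case False
    show ?thesis
    proof (rule filter_eqI)
      fix P
      have "{x \<in> succs (joined V) (vertex n v). \<not> eventually P (contour_at (joined V) x)} =
          vertex n ` {w \<in> succs (V n) v. \<not> (\<forall>\<^sub>F x in contour_at (V n) w. P (vertex n x))}"
        unfolding succs_joined by (auto simp: IH eventually_filtermap)
      then show "eventually P (contour_at (joined V) (vertex n v)) \<longleftrightarrow>
          eventually P (filtermap (vertex n) (contour_at (V n) v))"
        using False
        by (simp add: eventually_filtermap eventually_contour_at_iff cascade_joined V max_elems_joined
            finite_image_iff inj_vertex)
    qed
  qed
qed

lemma bij_betw_succs_joined_root:
  "bij_betw (\<lambda>n. vertex n (cascade_root (V n))) UNIV (succs (joined V) 0)"
  unfolding succs_joined_root bij_betw_def by (auto simp: inj_on_def)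

lemma sequential_joined:
  assumes "\<And>n. sequential (V n)"
  shows "sequential (joined V)"
  unfolding sequential_def
proof (intro ballI)
  fix x assume x: "x \<in> Field (joined V) - max_elems (joined V)"
  show "countable (succs (joined V) x) \<and> infinite (succs (joined V) x)"
  proof (cases x rule: vertex_cases)
    case zero
    then show ?thesis
      using bij_betw_succs_joined_root bij_betw_finite infinite_UNIV_nat by auto
  next
    case (vertex n v)
    then have "v \<in> Field (V n) - max_elems (V n)"
      using x by (auto simp: Field_joined max_elems_joined)
    then show ?thesis
      using assms[of n] unfolding vertex succs_joined sequential_def
      by (simp add: finite_image_iff inj_vertex)
  qed
qed

lemma monotone_joined:
  assumes "\<And>n. monotone_cascade (V n)" "mono (\<lambda>n. cascade_rank (V n))"
  shows "monotone_cascade (joined V)"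
  unfolding monotone_cascade_def
proof (intro ballI)
  fix x assume x: "x \<in> Field (joined V) - max_elems (joined V)"
  show "\<exists>e :: nat \<Rightarrow> nat. bij_betw e UNIV (succs (joined V) x) \<and> mono (\<lambda>n. rank_at (joined V) (e n))"
  proof (cases x rule: vertex_cases)
    case zero
    then show ?thesis
      using bij_betw_succs_joined_root assms(2) unfolding cascade_rank_def
      by (intro exI[of _ "\<lambda>n. vertex n (cascade_root (V n))"]) (simp add: rank_at_joined)
  next
    case (vertex n v)
    then have "v \<in> Field (V n) - max_elems (V n)"
      using x by (auto simp: Field_joined max_elems_joined)
    then obtain e :: "nat \<Rightarrow> nat" where e: "bij_betw e UNIV (succs (V n) v)" "mono (\<lambda>n'. rank_at (V n) (e n'))"
      using assms(1)[of n] unfolding monotone_cascade_def by blast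
    have "bij_betw (vertex n \<circ> e) UNIV (succs (joined V) x)"
      unfolding vertex succs_joined
      by (rule bij_betw_trans[OF e(1)]) (rule inj_on_imp_bij_betw[OF inj_vertex])
    then show ?thesis
      using e(2) by (intro exI[of _ "vertex n \<circ> e"]) (simp add: rank_at_joined)
  qed
qed

lemma cascade_root_joined: "cascade_root (joined V) = 0"
  by (rule cascade_root_eq[OF cascade_joined is_least_joined])

lemma cascade_rank_joined: "cascade_rank (joined V) = strict_sup (\<lambda>n. cascade_rank (V n))"
  unfolding cascade_rank_def cascade_root_joined
  using rank_at_eq_strict_sup[OF cascade_joined max_elems_joined(1) bij_betw_succs_joined_root]
  by (simp add: rank_at_joined)

lemma contour_joined: "contour (joined V) = limf (\<lambda>n. filtermap (vertex n) (contour (V n)))"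
  unfolding contour_def cascade_root_joined
  using contour_at_eq_limf[OF cascade_joined max_elems_joined(1) bij_betw_succs_joined_root]
  by (simp add: contour_at_joined)

end

text \<open>A limit is realised by joining the cascades of its pieces. Disjointness of the carriers
  makes the combined labelling injective.\<close>

lemma contour_on_imp_cascade:
  assumes "contour_on a X G"
  shows "\<exists>(V :: nat rel) (l :: nat \<Rightarrow> nat). cascade V \<and> sequential V \<and> monotone_cascade V \<and>
    cascade_rank V = a \<and> inj_on l (max_elems V) \<and> l ` max_elems V = X \<and> G = filtermap l (contour V)"
  using assms
proof (induction rule: contour_on.induct)
  case (point x)
  let ?V = "{(0, 0)} :: nat rel"
  have field: "Field ?V = {0}" and under: "under ?V v \<subseteq> {0}" for v
    by (auto simp: under_def)
  have max: "max_elems ?V = {0}"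
    by (auto simp: max_elems_def aboveS_def)
  have "branch ?V C \<Longrightarrow> C \<subseteq> {0}" for C
    by (auto simp: branch_def Chains_def)
  then have fin: "branch ?V C \<Longrightarrow> finite C" for C
    using finite_subset by blast
  have least: "is_least ?V 0"
    by (auto simp: is_least_def)
  have casc: "cascade ?V"
    unfolding cascade_def tree_def using fin least
    by (auto simp: order_on_defs refl_on_def trans_def antisym_def total_on_def under_def)
  have root: "cascade_root ?V = 0"
    by (rule cascade_root_eq[OF casc least])
  have "principal {x} = filtermap (\<lambda>_. x) (contour ?V)"
    unfolding contour_def root contour_at_rec[OF casc, of 0] max by simp
  moreover have "cascade_rank ?V = 0"
    unfolding cascade_rank_def root rank_at_rec[OF casc, of 0] max by simp
  moreover have "sequential ?V" "monotone_cascade ?V"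
    unfolding sequential_def monotone_cascade_def max field by auto
  ultimately show ?case
    using casc max by (intro exI[of _ ?V] exI[of _ "\<lambda>_. x"]) auto
next
  case (lim a X G)
  from lim.IH have "\<exists>V. \<forall>n. \<exists>l :: nat \<Rightarrow> nat. cascade (V n :: nat rel) \<and> sequential (V n) \<and> monotone_cascade (V n) \<and>
    cascade_rank (V n) = a n \<and> inj_on l (max_elems (V n)) \<and> l ` max_elems (V n) = X n \<and>
    G n = filtermap l (contour (V n))"
    by (intro choice allI)
  then obtain V where "\<forall>n. \<exists>l :: nat \<Rightarrow> nat. cascade (V n :: nat rel) \<and> sequential (V n) \<and> monotone_cascade (V n) \<and>
    cascade_rank (V n) = a n \<and> inj_on l (max_elems (V n)) \<and> l ` max_elems (V n) = X n \<and>
    G n = filtermap l (contour (V n))" ..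
  from choice[OF this] obtain l :: "nat \<Rightarrow> nat \<Rightarrow> nat"
    where V: "\<And>n. cascade (V n)" "\<And>n. sequential (V n)" "\<And>n. monotone_cascade (V n)"
    "\<And>n. cascade_rank (V n) = a n" and l: "\<And>n. inj_on (l n) (max_elems (V n))" "\<And>n. l n ` max_elems (V n) = X n"
    "\<And>n. G n = filtermap (l n) (contour (V n))"
    by blast
  \<comment> \<open>Subtracting 1 undoes the \<open>Suc\<close> in \<open>vertex\<close>. The value
    at 0 does not matter, since the root is not maximal.\<close>
  define k where "k x = (case prod_decode (x - 1) of (n, v) \<Rightarrow> l n v)" for x
  have k: "k (vertex n v) = l n v" for n v
    by (simp add: k_def vertex_def)
  have max: "x \<in> max_elems (joined V) \<longleftrightarrow> (\<exists>n. \<exists>v\<in>max_elems (V n). x = vertex n v)" for x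
    by (cases x rule: vertex_cases) (auto simp: max_elems_joined[OF V(1)])
  have "inj_on k (max_elems (joined V))"
  proof (rule inj_onI)
    fix x y assume "x \<in> max_elems (joined V)" "y \<in> max_elems (joined V)" and eq: "k x = k y"
    then obtain n v m w where x: "x = vertex n v" "v \<in> max_elems (V n)" and y: "y = vertex m w" "w \<in> max_elems (V m)"
      unfolding max by blast
    have "k x \<in> X n" "k y \<in> X m"
      using x y l(2) by (auto simp: k)
    then have "n = m"
      using disjoint_family_unique[OF lim.hyps(3)] eq by auto
    then show "x = y"
      using eq x y inj_onD[OF l(1)] by (auto simp: k)
  qed
  moreover have "k ` max_elems (joined V) = (\<Union>n. X n)"
  proof -
    have "max_elems (joined V) = (\<Union>n. vertex n ` max_elems (V n))"
      using max by blast
    then show ?thesis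
      by (simp add: image_UN image_image k l(2))
  qed
  moreover have "limf G = filtermap k (contour (joined V))"
    unfolding contour_joined[OF V(1)] filtermap_limf by (simp add: filtermap_filtermap k l(3)[abs_def])
  ultimately show ?case
    using cascade_joined[OF V(1)] sequential_joined[OF V(1,2)] monotone_joined[OF V(1,3)] cascade_rank_joined[OF V(1)]
      V(4) lim.hyps(2)
    by (intro exI[of _ "joined V"] exI[of _ k]) simp
qed

lemma contour_on_imp_ms_contours:
  assumes "contour_on a X G"
  shows "G \<in> ms_contours a"
  using contour_on_imp_cascade[OF assms] unfolding ms_contours_def by blast

text \<open>With both translations available, the P-hierarchy can be handled without cascades from
  here on.\<close>

lemma contains_ms_contour_iff: "contains_ms_contour u a \<longleftrightarrow> (\<exists>X F. contour_on a X F \<and> u \<le> F)"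
  unfolding contains_ms_contour_def using ms_contours_imp_contour_on contour_on_imp_ms_contours by blast


section \<open>Existence of ideal ultrafilters in the P-hierarchy\<close>

definition cascade_code :: "nat rel \<times> (nat \<Rightarrow> nat) \<Rightarrow> nat set" where
  "cascade_code p = (\<lambda>q. prod_encode (0, prod_encode q)) ` fst p \<union> (\<lambda>n. prod_encode (1, n)) ` function_code (snd p)"

lemma inj_cascade_code: "inj cascade_code"
proof (rule injI, rule prod_eqI)
  fix p q assume eq: "cascade_code p = cascade_code q"
  have "fst p = {x. prod_encode (0, prod_encode x) \<in> cascade_code p}" for p
    by (auto simp: cascade_code_def)
  then show "fst p = fst q"
    using eq by metis
  have "function_code (snd p) = {n. prod_encode (1, n) \<in> cascade_code p}" for p
    by (auto simp: cascade_code_def)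
  then have "function_code (snd p) = function_code (snd q)"
    using eq by metis
  then show "snd p = snd q"
    by (rule injD[OF inj_function_code])
qed

text \<open>A contour is determined by an order and a labelling, which together are coded by one set
  of numbers. The list \<open>h\<close> may also take values that are not contours of rank
  \<gamma>.\<close>

lemma continuum_hypothesis_ms_contours:
  assumes continuum_hypothesis
  shows "\<exists>h. ms_contours \<gamma> \<subseteq> h ` {..<\<omega>\<^sub>1}"
proof -
  obtain e where e: "e ` {..<\<omega>\<^sub>1} = (UNIV :: nat set set)"
    by (rule continuum_hypothesis_enum[OF assms])
  define h where "h a = (case inv cascade_code (e a) of (V, l) \<Rightarrow> filtermap l (contour V))" for a
  have "filtermap l (contour V) \<in> h ` {..<\<omega>\<^sub>1}" for V :: "nat rel" and l :: "nat \<Rightarrow> nat"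
  proof -
    have "cascade_code (V, l) \<in> e ` {..<\<omega>\<^sub>1}"
      unfolding e by simp
    then obtain a where "a < \<omega>\<^sub>1" "e a = cascade_code (V, l)"
      by auto
    then show ?thesis
      by (intro image_eqI[of _ _ a]) (simp_all add: h_def inv_f_f[OF inj_cascade_code])
  qed
  then show ?thesis
    unfolding ms_contours_def by blast
qed

section \<open>Coherent contours with ranks cofinal below a countable ordinal\<close>

text \<open>Entry \<open>r n i\<close> will be the rank of the n-th contour on piece
  \<open>i\<close>. The clause on zeros reflects that principal pieces cannot be raised; it holds
  because the entries are either all zero or all positive.\<close>

lemma increasing_fundamental_sequences:
  assumes "1 < \<gamma>" "\<gamma> < \<omega>\<^sub>1"
  shows "\<exists>r :: nat \<Rightarrow> nat \<Rightarrow> ordinal. (\<forall>n. mono (r n)) \<and> (\<forall>n i. r n i < \<omega>\<^sub>1) \<and> (\<forall>n. strict_sup (r n) < \<gamma>) \<and>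
    (\<forall>\<beta><\<gamma>. \<exists>n. \<beta> \<le> strict_sup (r n)) \<and> (\<forall>n i. r n i \<le> r (Suc n) i \<and> (r n i = 0 \<longrightarrow> r (Suc n) i = 0))"
proof -
  let ?two = "strict_sup (\<lambda>_. 1)"
  have one: "1 < \<omega>\<^sub>1"
    by (rule one_less_omega_one)
  obtain g where g: "mono g" "\<And>n. g n < \<omega>\<^sub>1" "strict_sup g = \<gamma>"
    using ordinal_fundamental_sequence[of \<gamma>] assms by (metis less_imp_le)
  have g\<gamma>: "g n < \<gamma>" for n
    using less_strict_sup[of g n] g(2,3) by blast
  have two: "?two \<le> \<gamma>"
    using less_strict_sup_iff[of "\<lambda>_. 1" \<gamma>] one assms(1) by (meson not_le)
  have "\<exists>A :: nat \<Rightarrow> nat \<Rightarrow> ordinal. (\<forall>m. mono (A m) \<and> (\<forall>i. A m i < \<omega>\<^sub>1) \<and> strict_sup (A m) < \<gamma> \<and>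
      g m \<le> strict_sup (A m)) \<and> ((\<forall>m i. A m i = 0) \<or> (\<forall>m i. A m i \<noteq> 0))"
  proof (cases "\<gamma> = ?two")
    \<comment> \<open>\<open>?two\<close> is the ordinal 2. Below it only ranks up to 1 are
      required, and constant zero sequences provide them.\<close>
    case True
    have "g m \<le> 1" for m
      using g\<gamma>[of m] less_strict_sup_iff[of "\<lambda>_. 1" "g m"] one unfolding True by blast
    moreover have "(0::ordinal) < \<omega>\<^sub>1"
      using one zero_ordinal_le le_less_trans by blast
    ultimately show ?thesis
      using assms(1) by (intro exI[of _ "\<lambda>_ _. 0"]) (simp add: strict_sup_const_zero mono_def)
  next
    case False
    then have two: "?two < \<gamma>"
      using two by simp
    \<comment> \<open>A target of at least 2 leaves room for a sequence without zeros, and it is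
      still below \<gamma>.\<close>
    have "\<exists>a :: nat \<Rightarrow> ordinal. mono a \<and> (\<forall>i. a i < \<omega>\<^sub>1) \<and> strict_sup a = max ?two (g m) \<and> (\<forall>i. a i \<noteq> 0)" for m
    proof -
      have "1 \<le> max ?two (g m)"
        using strict_sup_ge_one[of "\<lambda>_. 1"] one by (simp add: le_max_iff_disj)
      moreover have "max ?two (g m) < \<omega>\<^sub>1"
        using two g(2)[of m] assms(2) by auto
      ultimately obtain a where a: "mono a" "\<And>i. a i < \<omega>\<^sub>1" "strict_sup a = max ?two (g m)"
        using ordinal_fundamental_sequence by blast
      have "strict_sup (\<lambda>i. max 1 (a i)) = max ?two (strict_sup a)"
        by (rule strict_sup_max) (use one a(2) in auto)
      then have "strict_sup (\<lambda>i. max 1 (a i)) = max ?two (g m)"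
        using a(3) by simp
      moreover have "mono (\<lambda>i. max 1 (a i))"
        by (intro monoI max.mono monoD[OF a(1)]) simp_all
      moreover have "max 1 (a i) \<noteq> 0" for i
        unfolding one_le_ordinal_iff[symmetric] by simp
      ultimately show ?thesis
        using a(2) one by (intro exI[of _ "\<lambda>i. max 1 (a i)"]) simp
    qed
    then have "\<forall>m. \<exists>a :: nat \<Rightarrow> ordinal. mono a \<and> (\<forall>i. a i < \<omega>\<^sub>1) \<and> strict_sup a = max ?two (g m) \<and> (\<forall>i. a i \<noteq> 0)"
      by blast
    from choice[OF this] obtain A :: "nat \<Rightarrow> nat \<Rightarrow> ordinal" where
      "\<forall>m. mono (A m) \<and> (\<forall>i. A m i < \<omega>\<^sub>1) \<and> strict_sup (A m) = max ?two (g m) \<and> (\<forall>i. A m i \<noteq> 0)"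
      by blast
    then show ?thesis
      using two g\<gamma> by (intro exI[of _ A]) auto
  qed
  then obtain A :: "nat \<Rightarrow> nat \<Rightarrow> ordinal" where A: "\<And>m. mono (A m)" "\<And>m i. A m i < \<omega>\<^sub>1" "\<And>m. strict_sup (A m) < \<gamma>"
      "\<And>m. g m \<le> strict_sup (A m)" "(\<forall>m i. A m i = 0) \<or> (\<forall>m i. A m i \<noteq> 0)"
    by blast
  \<comment> \<open>Running pointwise maxima make the rows increase; \<open>strict_sup_max\<close>
    keeps their strict suprema below \<gamma>.\<close>
  define r where "r = rec_nat (A 0) (\<lambda>n f i. max (f i) (A (Suc n) i))"
  have r: "r 0 = A 0" "\<And>n. r (Suc n) = (\<lambda>i. max (r n i) (A (Suc n) i))"
    by (simp_all add: r_def)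
  have main: "mono (r n) \<and> (\<forall>i. r n i < \<omega>\<^sub>1) \<and> strict_sup (r n) < \<gamma> \<and> g n \<le> strict_sup (r n) \<and>
    ((\<forall>m i. A m i = 0) \<longrightarrow> (\<forall>i. r n i = 0)) \<and> ((\<forall>m i. A m i \<noteq> 0) \<longrightarrow> (\<forall>i. r n i \<noteq> 0))" for n
  proof (induction n)
    case 0
    show ?case using A by (simp add: r)
  next
    case (Suc n)
    have "strict_sup (r (Suc n)) = max (strict_sup (r n)) (strict_sup (A (Suc n)))"
      unfolding r by (rule strict_sup_max) (use Suc A in auto)
    moreover have "mono (r (Suc n))"
      unfolding r using Suc by (intro monoI max.mono monoD[OF A(1)]) (auto dest: monoD)
    ultimately show ?case
      using Suc A(2,3,4)[of "Suc n"] by (auto simp: r le_max_iff_disj max_def)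
  qed
  have "\<exists>n. \<beta> \<le> strict_sup (r n)" if "\<beta> < \<gamma>" for \<beta>
    using that main less_strict_sup_iff[of g \<beta>, OF g(2)] g(3) by (meson order_trans)
  moreover have "r n i \<le> r (Suc n) i \<and> (r n i = 0 \<longrightarrow> r (Suc n) i = 0)" for n i
    using A(5) main by (auto simp: r)
  ultimately show ?thesis
    using main by (intro exI[of _ r]) blast
qed

text \<open>In each column \<open>i\<close> the contours are raised successively within
  \<open>X i\<close>, and each row is then a limit over one and the same partition, as fusion
  demands.\<close>

lemma coherent_contours:
  assumes "1 < \<gamma>" "\<gamma> < \<omega>\<^sub>1"
  shows "\<exists>(X :: nat \<Rightarrow> nat set) (G :: nat \<Rightarrow> nat \<Rightarrow> nat filter) b Z. disjoint_family X \<and>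
    (\<forall>n i. eventually (\<lambda>x. x \<in> X i) (G n i)) \<and> (\<forall>n i. \<exists>a Y. contour_on a Y (G n i)) \<and>
    (\<forall>n i. G (Suc n) i \<le> G n i) \<and> (\<forall>n. contour_on (b n) (Z n) (limf (G n))) \<and>
    (\<forall>n. b n < \<gamma>) \<and> (\<forall>\<beta><\<gamma>. \<exists>n. \<beta> \<le> b n)"
proof -
  obtain r :: "nat \<Rightarrow> nat \<Rightarrow> ordinal" where r: "\<And>n. mono (r n)" "\<And>n i. r n i < \<omega>\<^sub>1" "\<And>n. strict_sup (r n) < \<gamma>"
    "\<And>\<beta>. \<beta> < \<gamma> \<Longrightarrow> \<exists>n. \<beta> \<le> strict_sup (r n)" "\<And>n i. r n i \<le> r (Suc n) i" "\<And>n i. r n i = 0 \<longrightarrow> r (Suc n) i = 0"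
    using increasing_fundamental_sequences[OF assms] by blast
  obtain X :: "nat \<Rightarrow> nat set" where X: "disjoint_family X" "\<And>i. infinite (X i)"
    by (rule infinite_partition[OF infinite_UNIV_nat]) (rule that)
  have "\<exists>f. \<forall>n. (fst (f n) \<subseteq> X i \<and> contour_on (r n i) (fst (f n)) (snd (f n))) \<and> snd (f (Suc n)) \<le> snd (f n)" for i
  proof (rule dependent_nat_choice)
    show "\<exists>p. fst p \<subseteq> X i \<and> contour_on (r 0 i) (fst p) (snd p)"
      using ex_contour_on[OF X(2) r(2)] by simp
    fix p n assume p: "fst p \<subseteq> X i \<and> contour_on (r n i) (fst p) (snd p)"
    have "\<exists>Y H. Y \<subseteq> fst p \<and> H \<le> snd p \<and> contour_on (r (Suc n) i) Y H"
      by (rule contour_on_raise[OF conjunct2[OF p] r(5) r(2) r(6)])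
    then obtain Y H where "Y \<subseteq> fst p" "H \<le> snd p" "contour_on (r (Suc n) i) Y H"
      by blast
    then show "\<exists>q. (fst q \<subseteq> X i \<and> contour_on (r (Suc n) i) (fst q) (snd q)) \<and> snd q \<le> snd p"
      using p by (intro exI[of _ "(Y, H)"]) auto
  qed
  then have "\<forall>i. \<exists>f. \<forall>n. (fst (f n) \<subseteq> X i \<and> contour_on (r n i) (fst (f n)) (snd (f n))) \<and> snd (f (Suc n)) \<le> snd (f n)"
    by blast
  from choice[OF this] obtain f where f: "\<And>i n. fst (f i n) \<subseteq> X i" "\<And>i n. contour_on (r n i) (fst (f i n)) (snd (f i n))"
    "\<And>i n. snd (f i (Suc n)) \<le> snd (f i n)"
    by blast
  define G where "G n i = snd (f i n)" for n i
  have con: "contour_on (r n i) (fst (f i n)) (G n i)" for n i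
    using f(2) by (simp add: G_def)
  have "eventually (\<lambda>x. x \<in> X i) (G n i)" for n i
    using contour_on_eventually[OF con] by (rule eventually_mono) (use f(1) in blast)
  moreover have "contour_on (strict_sup (r n)) (\<Union>i. fst (f i n)) (limf (G n))" for n
  proof (rule contour_on.lim[OF con r(1)])
    show "disjoint_family (\<lambda>i. fst (f i n))"
      using X(1) f(1) by (rule disjoint_family_subset)
  qed
  moreover have "G (Suc n) i \<le> G n i" for n i
    using f(3) by (simp add: G_def)
  ultimately show ?thesis
    using X(1) con r(3,4)
    by (intro exI[of _ X] exI[of _ G] exI[of _ "\<lambda>n. strict_sup (r n)"] exI[of _ "\<lambda>n. \<Union>i. fst (f i n)"]) blast
qed

section \<open>Ultrafilters on the levels of the hierarchy\<close>

text \<open>Ranks below \<gamma> are secured by every condition, whose filter refines all the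
  coherent contours. Contours of rank \<gamma> are destroyed one per stage.\<close>

lemma ex_ideal_ultrafilter_P_class_countable:
  assumes CH: continuum_hypothesis
    and tall: "is_tall \<I>" and P: "is_P_ideal \<I>" and sing: "\<And>n. {n} \<in> \<I>"
    and \<gamma>: "1 < \<gamma>" "\<gamma> < \<omega>\<^sub>1"
  shows "\<exists>u. ideal_ultrafilter \<I> u \<and> u \<in> P_class \<gamma>"
proof -
  obtain X :: "nat \<Rightarrow> nat set" and G :: "nat \<Rightarrow> nat \<Rightarrow> nat filter" and b Z where X: "disjoint_family X"
    and GX: "\<And>n i. eventually (\<lambda>x. x \<in> X i) (G n i)" and con: "\<And>n i. \<exists>a Y. contour_on a Y (G n i)"
    and dec: "\<And>n i. G (Suc n) i \<le> G n i" and conG: "\<And>n. contour_on (b n) (Z n) (limf (G n))"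
    and b: "\<And>n. b n < \<gamma>" "\<And>\<beta>. \<beta> < \<gamma> \<Longrightarrow> \<exists>n. \<beta> \<le> b n"
    using coherent_contours[OF \<gamma>] by (elim exE conjE) blast
  have dec': "G n i \<le> G m i" if "m \<le> n" for m n i
    using that by (rule lift_Suc_antimono_le[of "\<lambda>n. G n i", OF dec])
  have limf_dec: "limf (G n) \<le> limf (G m)" if "m \<le> n" for m n
    using dec'[OF that] by (intro limf_mono) simp
  define F where "F = (INF n. limf (G n))"
  have evF: "eventually Q F \<longleftrightarrow> (\<exists>n. eventually Q (limf (G n)))" for Q
  proof -
    have "eventually Q (INF n\<in>UNIV. limf (G n)) \<longleftrightarrow> (\<exists>n\<in>UNIV. eventually Q (limf (G n)))"
    proof (rule eventually_INF_base)
      show "\<exists>x\<in>UNIV. limf (G x) \<le> inf (limf (G m)) (limf (G n))" for m n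
        using limf_dec by (intro bexI[of _ "max m n"]) auto
    qed simp
    then show ?thesis by (simp add: F_def)
  qed
  have frF: "frequently Q F \<longleftrightarrow> (\<forall>n. frequently Q (limf (G n)))" for Q
    by (simp add: frequently_def evF)
  \<comment> \<open>Comparing the traces \<open>\<Phi> U\<close> expresses inclusion modulo
    \<open>F\<close>.\<close>
  define \<Phi> where "\<Phi> U = inf F (principal U)" for U
  have ev\<Phi>: "eventually Q (\<Phi> U) \<longleftrightarrow> eventually (\<lambda>x. x \<in> U \<longrightarrow> Q x) F" for Q U
    by (simp add: \<Phi>_def eventually_inf_principal)
  have sub\<Phi>: "\<Phi> V \<le> \<Phi> U" if "V \<subseteq> U" for U V
    using that unfolding \<Phi>_def by (intro inf_mono) simp_all
  have self\<Phi>: "eventually (\<lambda>x. x \<in> U) (\<Phi> U)" for U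
    by (simp add: ev\<Phi>)
  define \<P> where "\<P> = {U. frequently (\<lambda>x. x \<in> U) F}"
  have proper: "\<Phi> U \<noteq> bot \<longleftrightarrow> U \<in> \<P>" for U
    by (simp add: trivial_limit_def ev\<Phi> \<P>_def frequently_def)
  obtain h where h: "ms_contours \<gamma> \<subseteq> h ` {..<\<omega>\<^sub>1}"
    using continuum_hypothesis_ms_contours[OF CH] by blast
  \<comment> \<open>The task of stage \<open>a\<close> is to put the complement of some member of
    \<open>h a\<close> into the ultrafilter; the guard skips entries of the list that are not
    contours of rank \<gamma>.\<close>
  define E where "E a U \<longleftrightarrow> (h a \<in> ms_contours \<gamma> \<longrightarrow>
    (\<exists>B. eventually (\<lambda>x. x \<in> B) (h a) \<and> eventually (\<lambda>x. x \<notin> B) (\<Phi> U)))" for a U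
  have "\<exists>u. ideal_ultrafilter \<I> u \<and> (\<forall>a<\<omega>\<^sub>1. \<exists>U\<in>\<P>. E a U \<and> u \<le> \<Phi> U)"
  proof (rule generic_ideal_ultrafilter[where le = "\<lambda>V U. \<Phi> V \<le> \<Phi> U", OF CH])
    have "UNIV \<in> \<P>"
      using contour_on_neq_bot[OF conG] by (simp add: \<P>_def frF)
    then show "\<P> \<noteq> {}" by blast
  next
    fix s assume s: "\<And>n. s n \<in> \<P>" "\<And>n. \<Phi> (s (Suc n)) \<le> \<Phi> (s n)"
    have s': "\<Phi> (s n) \<le> \<Phi> (s m)" if "m \<le> n" for m n
      using that by (rule lift_Suc_antimono_le[of "\<lambda>n. \<Phi> (s n)", OF s(2)])
    \<comment> \<open>The sets \<open>s n\<close> decrease only modulo \<open>F\<close>. Finite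
      intersections decrease literally and stay positive, as fusion requires.\<close>
    define A where "A k = (\<Inter>j\<in>{..k}. s j)" for k
    have "frequently (\<lambda>x. x \<in> A k) F" for k
    proof -
      have "eventually (\<lambda>x. x \<in> s j) (\<Phi> (s k))" if "j \<le> k" for j
        using filter_leD[OF s'[OF that] self\<Phi>] .
      then have "eventually (\<lambda>x. x \<in> A k) (\<Phi> (s k))"
        by (simp add: A_def eventually_ball_finite)
      then have "frequently (\<lambda>x. x \<in> A k) (\<Phi> (s k))"
        using s(1) proper by (intro eventually_frequently) auto
      then have "frequently (\<lambda>x. x \<in> A k) F"
        by (rule frequently_filter_mono[rotated]) (simp add: \<Phi>_def)
      then show ?thesis .
    qed
    moreover have "decseq A"
      unfolding decseq_def A_def by force
    ultimately obtain U where U: "\<And>n. frequently (\<lambda>x. x \<in> U) (limf (G n))"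
        "\<And>k n. \<not> frequently (\<lambda>x. x \<in> U - A k) (limf (G n))"
      using limf_fusion[of X G A, OF X GX dec] unfolding frF by blast
    have "\<Phi> U \<le> \<Phi> (s k)" for k
    proof (rule filter_leI)
      fix Q assume "eventually Q (\<Phi> (s k))"
      then have "eventually (\<lambda>x. x \<in> s k \<longrightarrow> Q x) F"
        by (simp add: ev\<Phi>)
      moreover have "eventually (\<lambda>x. x \<notin> U - A k) F"
        using U(2) unfolding evF frequently_def by blast
      ultimately have "eventually (\<lambda>x. x \<in> U \<longrightarrow> Q x) F"
        by eventually_elim (auto simp: A_def)
      then show "eventually Q (\<Phi> U)"
        by (simp add: ev\<Phi>)
    qed
    then show "\<exists>U\<in>\<P>. \<forall>n. \<Phi> U \<le> \<Phi> (s n)"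
      using U(1) by (auto simp: \<P>_def frF)
  next
    fix U A assume "U \<in> \<P>"
    then have "frequently (\<lambda>x. x \<in> (U \<inter> A) \<union> (U - A)) F"
      unfolding \<P>_def by (auto elim: frequently_elim1)
    then consider "U \<inter> A \<in> \<P>" | "U - A \<in> \<P>"
      unfolding \<P>_def frequently_Un by blast
    then show "\<exists>V\<in>\<P>. \<Phi> V \<le> \<Phi> U \<and> (eventually (\<lambda>x. x \<in> A) (\<Phi> V) \<or> eventually (\<lambda>x. x \<in> - A) (\<Phi> V))"
    proof cases
      case 1
      have "eventually (\<lambda>x. x \<in> A) (\<Phi> (U \<inter> A))"
        using self\<Phi> by (rule eventually_mono) blast
      then show ?thesis using 1 sub\<Phi>[of "U \<inter> A" U] by blast
    next
      case 2
      have "eventually (\<lambda>x. x \<in> - A) (\<Phi> (U - A))"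
        using self\<Phi> by (rule eventually_mono) blast
      then show ?thesis using 2 sub\<Phi>[of "U - A" U] by blast
    qed
  next
    fix U and f :: "nat \<Rightarrow> nat" assume U: "U \<in> \<P>"
    \<comment> \<open>The k-th set is chosen positive in row \<open>k\<close> and in a column beyond
      \<open>k\<close>, so that infinitely many of them are positive for every fixed row at
      arbitrarily late columns.\<close>
    have "\<forall>k. \<exists>p. k \<le> fst p \<and> snd p \<subseteq> U \<and> frequently (\<lambda>x. x \<in> snd p) (G k (fst p)) \<and> f ` snd p \<in> \<I>"
    proof
      fix k
      have "frequently (\<lambda>x. x \<in> U) (limf (G k))"
        using U by (simp add: \<P>_def frF)
      then obtain i where i: "k \<le> i" "frequently (\<lambda>x. x \<in> U) (G k i)"
        by (auto simp: frequently_limf frequently_sequentially)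
      obtain a Y where "contour_on a Y (G k i)"
        using con by blast
      then have "\<exists>V \<subseteq> U. frequently (\<lambda>x. x \<in> V) (G k i) \<and> f ` V \<in> \<I>"
        by (rule contour_on_ideal_image[OF tall P sing _ i(2)])
      then obtain V where "V \<subseteq> U" "frequently (\<lambda>x. x \<in> V) (G k i)" "f ` V \<in> \<I>"
        by blast
      then show "\<exists>p. k \<le> fst p \<and> snd p \<subseteq> U \<and> frequently (\<lambda>x. x \<in> snd p) (G k (fst p)) \<and> f ` snd p \<in> \<I>"
        using i(1) by (intro exI[of _ "(i, V)"]) simp
    qed
    from choice[OF this] obtain p where p: "\<And>k. k \<le> fst (p k)" "\<And>k. snd (p k) \<subseteq> U"
      "\<And>k. frequently (\<lambda>x. x \<in> snd (p k)) (G k (fst (p k)))" "\<And>k. f ` snd (p k) \<in> \<I>"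
      by blast
    have "\<exists>K V. infinite K \<and> (\<forall>k. V k \<subseteq> snd (p k)) \<and> (\<forall>k\<in>K. frequently (\<lambda>x. x \<in> V k) (G k (fst (p k)))) \<and>
        f ` (\<Union>k\<in>K. V k) \<in> \<I>"
      by (rule P_ideal_union_of_positive[OF tall P sing p(3,4)])
    then obtain K V where KV: "infinite K" "\<And>k. V k \<subseteq> snd (p k)"
      "\<And>k. k \<in> K \<Longrightarrow> frequently (\<lambda>x. x \<in> V k) (G k (fst (p k)))" "f ` (\<Union>k\<in>K. V k) \<in> \<I>"
      by (elim exE conjE) blast
    let ?W = "\<Union>k\<in>K. V k"
    have "frequently (\<lambda>x. x \<in> ?W) (limf (G n))" for n
      unfolding frequently_limf frequently_sequentially
    proof
      fix N
      obtain k where k: "max n N \<le> k" "k \<in> K"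
        using KV(1) unfolding infinite_nat_iff_unbounded_le by blast
      have "frequently (\<lambda>x. x \<in> ?W) (G k (fst (p k)))"
        using KV(3)[OF k(2)] by (rule frequently_subset) (use k(2) in blast)
      then have "frequently (\<lambda>x. x \<in> ?W) (G n (fst (p k)))"
        using k(1) by (intro frequently_filter_mono[OF dec'[of n k]]) simp_all
      then show "\<exists>i\<ge>N. frequently (\<lambda>x. x \<in> ?W) (G n i)"
        using k(1) p(1)[of k] by (intro exI[of _ "fst (p k)"]) simp
    qed
    then have "?W \<in> \<P>"
      by (simp add: \<P>_def frF)
    moreover have "?W \<subseteq> U"
      using KV(2) p(2) by blast
    ultimately show "\<exists>W\<in>\<P>. \<Phi> W \<le> \<Phi> U \<and> (\<exists>A. eventually (\<lambda>x. x \<in> A) (\<Phi> W) \<and> f ` A \<in> \<I>)"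
      using sub\<Phi>[of ?W U] self\<Phi>[of ?W] KV(4) by blast
  next
    fix U a assume U: "U \<in> \<P>" "a < \<omega>\<^sub>1"
    show "\<exists>V\<in>\<P>. \<Phi> V \<le> \<Phi> U \<and> E a V"
    proof (cases "h a \<in> ms_contours \<gamma>")
      case True
      then obtain Y where Y: "contour_on \<gamma> Y (h a)"
        using ms_contours_imp_contour_on by blast
      have "\<exists>B. eventually (\<lambda>x. x \<in> B) (h a) \<and> (\<forall>n. frequently (\<lambda>x. x \<in> U - B) (limf (G n)))"
        by (rule contour_on_rank_less_limf[OF X GX conG Y b(1)])
          (use U in \<open>simp_all add: \<P>_def frF limf_dec\<close>)
      then obtain B where B: "eventually (\<lambda>x. x \<in> B) (h a)" "U - B \<in> \<P>"
        by (auto simp: \<P>_def frF)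
      have "eventually (\<lambda>x. x \<notin> B) (\<Phi> (U - B))"
        using self\<Phi> by (rule eventually_mono) blast
      then have "E a (U - B)"
        using B(1) by (auto simp: E_def)
      then show ?thesis
        using B(2) sub\<Phi>[of "U - B" U] by blast
    next
      case False
      then show ?thesis using U(1) by (auto simp: E_def)
    qed
  qed (use proper in auto)
  then obtain u where u: "ideal_ultrafilter \<I> u" "\<And>a. a < \<omega>\<^sub>1 \<Longrightarrow> \<exists>U\<in>\<P>. E a U \<and> u \<le> \<Phi> U"
    by blast
  have "u \<noteq> bot"
    using u(1) by (simp add: ideal_ultrafilter_def ultrafilter_def)
  have "\<not> contains_ms_contour u \<gamma>"
  proof
    assume "contains_ms_contour u \<gamma>"
    then obtain a where a: "a < \<omega>\<^sub>1" "h a \<in> ms_contours \<gamma>" "u \<le> h a"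
      using h unfolding contains_ms_contour_def by blast
    obtain U where "E a U" "u \<le> \<Phi> U"
      using u(2)[OF a(1)] by blast
    then obtain B where "eventually (\<lambda>x. x \<in> B) u" "eventually (\<lambda>x. x \<notin> B) u"
      using a(2,3) filter_leD unfolding E_def by blast
    then have "eventually (\<lambda>_. False) u"
      by eventually_elim simp
    then show False
      using \<open>u \<noteq> bot\<close> by (simp add: trivial_limit_def)
  qed
  moreover have "contains_ms_contour u \<beta>" if \<beta>: "1 \<le> \<beta>" "\<beta> < \<gamma>" for \<beta>
  proof -
    obtain n where "\<beta> \<le> b n"
      using b(2) \<beta>(2) by blast
    then obtain H where H: "limf (G n) \<le> H" "contour_on \<beta> (Z n) H"
      using contour_on_lower[OF conG _ \<beta>(1)] by blast
    \<comment> \<open>Any stage of the chain serves; \<gamma> is just an available index.\<close>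
    obtain U where "u \<le> \<Phi> U"
      using u(2)[of \<gamma>] \<gamma>(2) by blast
    also have "\<Phi> U \<le> F"
      by (simp add: \<Phi>_def)
    also have "F \<le> limf (G n)"
      unfolding F_def by (rule INF_lower) simp
    finally show ?thesis
      using H unfolding contains_ms_contour_iff by (blast intro: order_trans)
  qed
  ultimately show ?thesis
    using u(1) \<gamma>(2) by (intro exI[of _ u]) (auto simp: P_class_def ideal_ultrafilter_def)
qed

text \<open>
  For \<open>\<omega>\<^sub>1\<close> the conditions are sequences of contours on the pieces of a fixed partition; the
  value \<open>bot\<close> marks the discarded pieces and does not contribute to \<open>limf\<close>.
\<close>

lemma ex_ideal_ultrafilter_P_class_omega_one:
  assumes CH: continuum_hypothesis
    and tall: "is_tall \<I>" and P: "is_P_ideal \<I>" and sing: "\<And>n. {n} \<in> \<I>"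
  shows "\<exists>u. ideal_ultrafilter \<I> u \<and> u \<in> P_class \<omega>\<^sub>1"
proof -
  obtain X :: "nat \<Rightarrow> nat set" where X: "disjoint_family X" "\<And>i. infinite (X i)"
    by (rule infinite_partition[OF infinite_UNIV_nat]) (rule that)
  \<comment> \<open>Excluding rank 0 ensures that every surviving piece can be raised later.\<close>
  define C where "C i H \<longleftrightarrow> H = bot \<or> (\<exists>a Y. 1 \<le> a \<and> Y \<subseteq> X i \<and> contour_on a Y H)" for i and H :: "nat filter"
  define \<P> where "\<P> = {G :: nat \<Rightarrow> nat filter. (\<exists>\<^sub>F i in sequentially. G i \<noteq> bot) \<and> (\<forall>i. C i (G i))}"
  define le where "le G' G \<longleftrightarrow> (\<forall>\<^sub>F i in sequentially. G' i \<le> (G i :: nat filter))" for G' G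
  \<comment> \<open>A rank of at least \<open>a\<close> is enough, since exact ranks are recovered
    by lowering.\<close>
  define E where "E a q \<longleftrightarrow> (\<exists>b Y H. a \<le> b \<and> contour_on b Y H \<and> limf q \<le> H)" for a q
  have restrict: "\<exists>q\<in>\<P>. le q G \<and> eventually (\<lambda>x. x \<in> B) (limf q)"
    if G: "G \<in> \<P>" and B: "\<exists>\<^sub>F i in sequentially. frequently (\<lambda>x. x \<in> B) (G i)" for G B
  proof -
    \<comment> \<open>Pieces on which \<open>B\<close> is not positive are discarded by setting them
      to \<open>bot\<close>.\<close>
    have "\<forall>i. \<exists>H. H \<le> G i \<and> eventually (\<lambda>x. x \<in> B) H \<and> C i H \<and> (frequently (\<lambda>x. x \<in> B) (G i) \<longrightarrow> H \<noteq> bot)"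
    proof
      fix i
      show "\<exists>H. H \<le> G i \<and> eventually (\<lambda>x. x \<in> B) H \<and> C i H \<and> (frequently (\<lambda>x. x \<in> B) (G i) \<longrightarrow> H \<noteq> bot)"
      proof (cases "frequently (\<lambda>x. x \<in> B) (G i)")
        case True
        then have "G i \<noteq> bot"
          by (auto simp: frequently_def)
        then obtain a Y where aY: "1 \<le> a" "Y \<subseteq> X i" "contour_on a Y (G i)"
          using G by (auto simp: \<P>_def C_def)
        obtain Y' H where "Y' \<subseteq> Y" "H \<le> G i" "eventually (\<lambda>x. x \<in> B) H" "contour_on a Y' H"
          using contour_on_restrict[OF aY(3) True] by blast
        then show ?thesis
          using aY(1,2) contour_on_neq_bot by (intro exI[of _ H]) (auto simp: C_def)
      next
        case False
        then show ?thesis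
          by (intro exI[of _ bot]) (auto simp: C_def)
      qed
    qed
    from choice[OF this] obtain q where q: "\<And>i. q i \<le> G i" "\<And>i. eventually (\<lambda>x. x \<in> B) (q i)" "\<And>i. C i (q i)"
        "\<And>i. frequently (\<lambda>x. x \<in> B) (G i) \<Longrightarrow> q i \<noteq> bot"
      by blast
    have "\<exists>\<^sub>F i in sequentially. q i \<noteq> bot"
      using B by (rule frequently_elim1) (rule q(4))
    then show ?thesis
      using q(1,2,3) by (intro bexI[of _ q]) (auto simp: \<P>_def le_def eventually_limf)
  qed
  have "\<exists>u. ideal_ultrafilter \<I> u \<and> (\<forall>a<\<omega>\<^sub>1. \<exists>p\<in>\<P>. E a p \<and> u \<le> limf p)"
  proof (rule generic_ideal_ultrafilter[where le = le, OF CH])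
    have "\<forall>i. \<exists>H. contour_on 1 (X i) H"
      using ex_frechet_contour[OF X(2)] by blast
    from choice[OF this] obtain G where G: "\<And>i. contour_on 1 (X i) (G i)"
      by blast
    have "C i (G i)" for i
      unfolding C_def using G order_refl by blast
    moreover have "G i \<noteq> bot" for i
      by (rule contour_on_neq_bot[OF G])
    ultimately have "G \<in> \<P>"
      by (simp add: \<P>_def)
    then show "\<P> \<noteq> {}" by blast
  next
    show "le p p" for p
      by (simp add: le_def)
    show "le p r" if "le p q" "le q r" for p q r
      using that unfolding le_def by eventually_elim (rule order_trans)
    show "limf p \<le> limf q" if "le p q" for p q
      using that unfolding le_def by (rule limf_mono)
    show "limf p \<noteq> bot" if "p \<in> \<P>" for p
      using that by (auto simp: \<P>_def trivial_limit_def eventually_limf frequently_def)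
  next
    fix s assume s: "\<And>n. s n \<in> \<P>" "\<And>n. le (s (Suc n)) (s n)"
    \<comment> \<open>The k-th condition contributes one surviving piece, chosen where the first
      \<open>k\<close> comparisons hold literally and not just almost everywhere. All other pieces
      of the lower bound are \<open>bot\<close>.\<close>
    let ?Q = "\<lambda>k i. s k i \<noteq> bot \<and> (\<forall>j<k. s (Suc j) i \<le> s j i)"
    have ex: "\<exists>i>N. ?Q k i" for k N
    proof -
      have "\<forall>\<^sub>F i in sequentially. \<forall>j\<in>{..<k}. s (Suc j) i \<le> s j i"
        using s(2) by (simp add: eventually_ball_finite le_def)
      moreover have "\<exists>\<^sub>F i in sequentially. s k i \<noteq> bot"
        using s(1) by (simp add: \<P>_def)
      ultimately have "\<exists>\<^sub>F i in sequentially. (\<forall>j\<in>{..<k}. s (Suc j) i \<le> s j i) \<and> s k i \<noteq> bot"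
        by (rule frequently_eventually_conj[rotated])
      then obtain i where "Suc N \<le> i" "(\<forall>j\<in>{..<k}. s (Suc j) i \<le> s j i) \<and> s k i \<noteq> bot"
        unfolding frequently_sequentially by blast
      then show ?thesis
        by (intro exI[of _ i]) auto
    qed
    have "\<exists>i. \<forall>k. ?Q k (i k) \<and> i k < i (Suc k)"
    proof (rule dependent_nat_choice)
      show "\<exists>x. ?Q 0 x"
        using ex by blast
      show "\<exists>y. ?Q (Suc k) y \<and> x < y" for x k
        using ex by blast
    qed
    then obtain i where Q: "\<And>k. ?Q k (i k)" and "\<And>k. i k < i (Suc k)"
      by blast
    then have i: "strict_mono i"
      by (simp add: strict_mono_Suc_iff)
    have chain: "s k (i k) \<le> s n (i k)" if "n \<le> k" for n k
      using that
    proof (induction rule: inc_induct)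
      case (step j)
      then show ?case using Q[of k] order_trans by blast
    qed simp
    define p where "p m = (if m \<in> range i then s (inv i m) m else bot)" for m
    have pi: "p (i k) = s k (i k)" for k
      unfolding p_def using strict_mono_imp_inj_on[OF i] by simp
    have "\<exists>\<^sub>F m in sequentially. p m \<noteq> bot"
      by (rule infinite_imp_frequently_sequentially[of "range i"])
        (use Q pi range_inj_infinite[OF strict_mono_imp_inj_on[OF i]] in auto)
    moreover have "C m (p m)" for m
      using s(1) by (auto simp: p_def \<P>_def C_def)
    moreover have "le p (s n)" for n
      unfolding le_def eventually_sequentially
    proof (intro exI allI impI)
      fix m assume m: "i n \<le> m"
      show "p m \<le> s n m"
      proof (cases "m \<in> range i")
        case True
        then obtain k where k: "m = i k" by blast
        then have "n \<le> k"
          using m strict_mono_less_eq[OF i] by simp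
        then show ?thesis
          unfolding k pi by (rule chain)
      qed (simp add: p_def)
    qed
    ultimately show "\<exists>p\<in>\<P>. \<forall>n. le p (s n)"
      by (intro bexI[of _ p]) (auto simp: \<P>_def)
  next
    fix G A assume G: "G \<in> \<P>"
    then have "\<exists>\<^sub>F i in sequentially. G i \<noteq> bot"
      by (simp add: \<P>_def)
    then have "\<exists>\<^sub>F i in sequentially. frequently (\<lambda>x. x \<in> A) (G i) \<or> frequently (\<lambda>x. x \<in> - A) (G i)"
      by (rule frequently_elim1) (simp flip: frequently_disj_iff)
    then have "(\<exists>\<^sub>F i in sequentially. frequently (\<lambda>x. x \<in> A) (G i)) \<or> (\<exists>\<^sub>F i in sequentially. frequently (\<lambda>x. x \<in> - A) (G i))"
      by (simp add: frequently_disj_iff)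
    then show "\<exists>q\<in>\<P>. le q G \<and> (eventually (\<lambda>x. x \<in> A) (limf q) \<or> eventually (\<lambda>x. x \<in> - A) (limf q))"
      using restrict[OF G, of A] restrict[OF G, of "- A"] by blast
  next
    fix G and f :: "nat \<Rightarrow> nat" assume G: "G \<in> \<P>"
    then have "\<exists>\<^sub>F i in sequentially. G i \<noteq> bot"
      by (simp add: \<P>_def)
    then obtain k :: "nat \<Rightarrow> nat" where k: "strict_mono k" "\<And>n. G (k n) \<noteq> bot"
      by (rule frequently_sequentially_subseq) (rule that)
    have "\<forall>n. \<exists>U. frequently (\<lambda>x. x \<in> U) (G (k n)) \<and> f ` U \<in> \<I>"
    proof
      fix n
      obtain a Y where "contour_on a Y (G (k n))"
        using G k(2)[of n] by (auto simp: \<P>_def C_def)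
      then show "\<exists>U. frequently (\<lambda>x. x \<in> U) (G (k n)) \<and> f ` U \<in> \<I>"
        using contour_on_ideal_image[OF tall P sing, of a Y "G (k n)" UNIV f] k(2)[of n] by auto
    qed
    from choice[OF this] obtain U where U: "\<And>n. frequently (\<lambda>x. x \<in> U n) (G (k n))" "\<And>n. f ` U n \<in> \<I>"
      by blast
    have "\<exists>K V. infinite K \<and> (\<forall>n. V n \<subseteq> U n) \<and> (\<forall>n\<in>K. frequently (\<lambda>x. x \<in> V n) (G (k n))) \<and>
        f ` (\<Union>n\<in>K. V n) \<in> \<I>"
      by (rule P_ideal_union_of_positive[OF tall P sing U])
    then obtain K V where KV: "infinite K" 
      "\<And>n. n \<in> K \<Longrightarrow> frequently (\<lambda>x. x \<in> V n) (G (k n))" "f ` (\<Union>n\<in>K. V n) \<in> \<I>"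
      by (elim exE conjE) blast
    have "infinite (k ` K)"
      using KV(1) finite_image_iff[OF inj_on_subset[OF strict_mono_imp_inj_on[OF k(1)] subset_UNIV]] by blast
    then have "\<exists>\<^sub>F i in sequentially. frequently (\<lambda>x. x \<in> (\<Union>n\<in>K. V n)) (G i)"
    proof (rule infinite_imp_frequently_sequentially)
      fix i assume "i \<in> k ` K"
      then obtain n where n: "n \<in> K" "i = k n" by blast
      show "frequently (\<lambda>x. x \<in> (\<Union>n\<in>K. V n)) (G i)"
        unfolding n(2) using KV(2)[OF n(1)] by (rule frequently_subset) (use n(1) in blast)
    qed
    then show "\<exists>q\<in>\<P>. le q G \<and> (\<exists>U. eventually (\<lambda>x. x \<in> U) (limf q) \<and> f ` U \<in> \<I>)"
      using restrict[OF G] KV(3) by blast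
  next
    fix G a assume G: "G \<in> \<P>" and a: "a < \<omega>\<^sub>1"
    have "\<forall>i. \<exists>b. G i \<noteq> bot \<longrightarrow> (\<exists>Y \<subseteq> X i. 1 \<le> b \<and> contour_on b Y (G i))"
    proof -
      have "\<forall>i. C i (G i)"
        using G by (simp add: \<P>_def)
      then show ?thesis
        unfolding C_def by blast
    qed
    from choice[OF this] obtain b where b: "\<And>i. G i \<noteq> bot \<Longrightarrow> \<exists>Y \<subseteq> X i. 1 \<le> b i \<and> contour_on (b i) Y (G i)"
      by blast
    \<comment> \<open>A common bound \<open>c\<close> for the countably many ranks lets every
      surviving piece be raised to the same rank, so the rank sequence is constant and in particular
      monotone.\<close>
    have "\<exists>c < \<omega>\<^sub>1. \<forall>d \<in> insert a (b ` {i. G i \<noteq> bot}). d < c"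
    proof (rule countable_ordinals_bounded)
      have "b i < \<omega>\<^sub>1" if "G i \<noteq> bot" for i
        using b[OF that] contour_on_less_omega_one by blast
      then show "d < \<omega>\<^sub>1" if "d \<in> insert a (b ` {i. G i \<noteq> bot})" for d
        using that a by blast
    qed simp
    then obtain c where c: "c < \<omega>\<^sub>1" "a < c" "\<And>i. G i \<noteq> bot \<Longrightarrow> b i < c"
      by auto
    have "\<forall>i. \<exists>p. G i \<noteq> bot \<longrightarrow> fst p \<subseteq> X i \<and> snd p \<le> G i \<and> contour_on c (fst p) (snd p)"
    proof
      fix i
      show "\<exists>p. G i \<noteq> bot \<longrightarrow> fst p \<subseteq> X i \<and> snd p \<le> G i \<and> contour_on c (fst p) (snd p)"
      proof (cases "G i = bot")
        case False
        then obtain Y where Y: "Y \<subseteq> X i" "1 \<le> b i" "contour_on (b i) Y (G i)"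
          using b by blast
        have "b i \<noteq> 0"
          using Y(2) one_le_ordinal_iff by blast
        then obtain Z H where "Z \<subseteq> Y" "H \<le> G i" "contour_on c Z H"
          using contour_on_raise[OF Y(3) less_imp_le[OF c(3)[OF False]] c(1)] by blast
        then show ?thesis
          using Y(1) by (intro exI[of _ "(Z, H)"]) auto
      qed simp
    qed
    from choice[OF this] obtain p where p: "\<And>i. G i \<noteq> bot \<Longrightarrow> fst (p i) \<subseteq> X i"
      "\<And>i. G i \<noteq> bot \<Longrightarrow> snd (p i) \<le> G i" "\<And>i. G i \<noteq> bot \<Longrightarrow> contour_on c (fst (p i)) (snd (p i))"
      by blast
    define q where "q i = (if G i = bot then bot else snd (p i))" for i
    have c1: "1 \<le> c"
      using c(2) one_le_ordinal_iff not_less_zero_ordinal by metis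
    have "C i (q i)" for i
    proof (cases "G i = bot")
      case False
      then show ?thesis
        using p(1,3)[OF False] c1 unfolding C_def q_def by auto
    qed (simp add: C_def q_def)
    moreover have fr: "\<exists>\<^sub>F i in sequentially. G i \<noteq> bot"
      using G by (simp add: \<P>_def)
    have "\<exists>\<^sub>F i in sequentially. q i \<noteq> bot"
      using fr by (rule frequently_elim1) (use contour_on_neq_bot[OF p(3)] in \<open>simp add: q_def\<close>)
    ultimately have "q \<in> \<P>"
      by (simp add: \<P>_def)
    moreover have "le q G"
      using p(2) by (simp add: le_def q_def)
    moreover have "E a q"
    proof -
      obtain k :: "nat \<Rightarrow> nat" where k: "strict_mono k" "\<And>n. G (k n) \<noteq> bot" "range k = {i. G i \<noteq> bot}"
      proof
        let ?k = "enumerate {i. G i \<noteq> bot}"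
        have inf: "infinite {i. G i \<noteq> bot}"
          using fr by (simp add: frequently_cofinite flip: cofinite_eq_sequentially)
        show "strict_mono ?k"
          using strict_mono_enumerate[OF inf] .
        show "G (?k n) \<noteq> bot" for n
          using enumerate_in_set[OF inf, of n] by simp
        show "range ?k = {i. G i \<noteq> bot}"
          by (rule range_enumerate[OF inf])
      qed
      have "disjoint_family (\<lambda>n. X (k n))"
        using X(1) strict_mono_imp_inj_on[OF k(1)] unfolding disjoint_family_on_def by (metis UNIV_I injD)
      then have "disjoint_family (\<lambda>n. fst (p (k n)))"
        using p(1)[OF k(2)] by (rule disjoint_family_subset)
      then have con: "contour_on (strict_sup (\<lambda>_. c)) (\<Union>n. fst (p (k n))) (limf (\<lambda>n. snd (p (k n))))"
        using contour_on.lim[of "\<lambda>_. c" "\<lambda>n. fst (p (k n))" "\<lambda>n. snd (p (k n))"] p(3)[OF k(2)] by (simp add: mono_def)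
      \<comment> \<open>Discarded pieces satisfy every property eventually, so only the surviving
        ones, enumerated by \<open>k\<close>, restrict membership.\<close>
      have "limf q \<le> limf (\<lambda>n. snd (p (k n)))"
      proof (rule filter_leI)
        fix R assume "eventually R (limf (\<lambda>n. snd (p (k n))))"
        then obtain N where N: "\<And>n. N \<le> n \<Longrightarrow> eventually R (snd (p (k n)))"
          by (auto simp: eventually_limf eventually_sequentially)
        have "eventually R (q i)" if "k N \<le> i" for i
        proof (cases "G i = bot")
          case False
          then obtain n where "i = k n"
            using k(3) by blast
          then show ?thesis
            using N[of n] that strict_mono_less_eq[OF k(1)] False by (simp add: q_def)
        qed (simp add: q_def)
        then show "eventually R (limf q)"
          by (auto simp: eventually_limf eventually_sequentially)
      qed
      moreover have "a \<le> strict_sup (\<lambda>_. c)"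
        using c(2) less_strict_sup_const[OF c(1)] by simp
      ultimately show ?thesis
        using con unfolding E_def by blast
    qed
    ultimately show "\<exists>q\<in>\<P>. le q G \<and> E a q" by blast
  qed
  then obtain u where u: "ideal_ultrafilter \<I> u" "\<And>a. a < \<omega>\<^sub>1 \<Longrightarrow> \<exists>p\<in>\<P>. E a p \<and> u \<le> limf p"
    by blast
  have "contains_ms_contour u \<alpha>" if \<alpha>: "1 \<le> \<alpha>" "\<alpha> < \<omega>\<^sub>1" for \<alpha>
  proof -
    obtain p b Y H where H: "u \<le> limf p" "limf p \<le> H" "\<alpha> \<le> b" "contour_on b Y H"
      using u(2)[OF \<alpha>(2)] unfolding E_def by blast
    then obtain H' where "H \<le> H'" "contour_on \<alpha> Y H'"
      using contour_on_lower[OF H(4,3) \<alpha>(1)] by blast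
    then show ?thesis
      using H(1,2) unfolding contains_ms_contour_iff by (blast intro: order_trans)
  qed
  then show ?thesis
    using u(1) by (intro exI[of _ u]) (auto simp: P_class_def ideal_ultrafilter_def)
qed

text \<open>Contours of rank 1 are free, so no principal ultrafilter contains one; the image of its
  generating singleton is a singleton and hence in the ideal.\<close>

lemma ex_ideal_ultrafilter_P_class_one:
  assumes sing: "\<And>n. {n} \<in> \<I>"
  shows "\<exists>u. ideal_ultrafilter \<I> u \<and> u \<in> P_class 1"
proof -
  let ?u = "principal {0 :: nat}"
  have uf: "ultrafilter ?u"
    by (auto simp: ultrafilter_def eventually_principal principal_eq_bot_iff)
  have "\<not> contains_ms_contour ?u 1"
  proof
    assume "contains_ms_contour ?u 1"
    then obtain X F where F: "contour_on 1 X F" "?u \<le> F"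
      unfolding contains_ms_contour_iff by blast
    have "(1::ordinal) \<noteq> 0"
      using one_le_ordinal_iff by blast
    then have "eventually (\<lambda>x. x \<notin> {0}) F"
      by (intro contour_on_free[OF F(1)]) simp_all
    then show False
      using filter_leD[OF F(2)] by (auto simp: eventually_principal)
  qed
  moreover have "\<not> (1 \<le> \<beta> \<and> \<beta> < 1)" for \<beta> :: ordinal
    using leD by blast
  ultimately have "?u \<in> P_class 1"
    using uf one_less_omega_one by (auto simp: P_class_def)
  moreover have "ideal_ultrafilter \<I> ?u"
    unfolding ideal_ultrafilter_def using uf sing by (auto intro!: exI[of _ "{0}"] simp: eventually_principal)
  ultimately show ?thesis by blast
qed

theorem theorem3p1:
  fixes \<I> :: "nat set set" and \<gamma> :: ordinal
  assumes "continuum_hypothesis"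
    and "is_ideal \<I>" and "is_tall \<I>" and "is_P_ideal \<I>"
    and "\<forall>n. {n} \<in> \<I>"
    and "1 \<le> \<gamma>" and "\<gamma> \<le> \<omega>\<^sub>1"
  shows "\<exists>u :: nat filter. ideal_ultrafilter \<I> u \<and> u \<in> P_class \<gamma>"
proof -
  consider "\<gamma> = 1" | "1 < \<gamma>" "\<gamma> < \<omega>\<^sub>1" | "\<gamma> = \<omega>\<^sub>1"
    using assms(6,7) by fastforce
  then show ?thesis
  proof cases
    case 1
    then show ?thesis using ex_ideal_ultrafilter_P_class_one[of \<I>] assms(5) by blast
  next
    case 2
    then show ?thesis
      using ex_ideal_ultrafilter_P_class_countable[OF assms(1,3,4)] assms(5) by blast
  next
    case 3
    then show ?thesis
      using ex_ideal_ultrafilter_P_class_omega_one[OF assms(1,3,4)] assms(5) by blast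
  qed
qed

end
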